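(* Let $\mathbb K$ be a field of characteristic zero and let $A\subset \mathbb K^{d+1}$ be a homogeneous non-pyramidal configuration with cardinality $n(A)$ and affine dimension $d(A)=d$. Let $\iota(A)$ be the maximum of $\eta(I)$ over all iterated circuits $I\subset A$, and let $\rho(A)$ be the maximum of $\operatorname{rank} M_{\underline\sigma}(A)$ over all maximal chains $\underline\sigma$ of supports of vectors in $\ker_{\mathbb K}(A)$. Then $$n(A)-1-\rho(A)=d(A)-\iota(A).$$
   Context: A configuration over $\mathbb K$ is a finite indexed family $A=\{a_1,\dots,a_n\}\subset\mathbb K^e$ of not necessarily distinct points; it is identified with the $e\times n$ matrix with columns $a_i$, and subconfigurations correspond to subsets of the index set. $n(A)=n$; $d(A)$ is the dimension of the affine span of $A$; $m(A)=n(A)-d(A)-1$; $L(S)$ is the $\mathbb K$-linear span of $S$. $A$ is homogeneous if $(1,\dots,1)$ lies in the row span of the matrix $A$. $A$ is a pyramid if some affine hyperplane contains all points of $A$ except one (equivalently, some $a_i$ is not in the affine span of the other points); otherwise it is non-pyramidal. Circuit: a configuration $Z$ which is affinely dependent while every proper subconfiguration is affinely independent. A circuit of affine dimension $0$ is a pair of equal points. Minimally linearly dependent: linearly dependent while every proper subconfiguration is linearly independent. Iterated circuit of length $p$ in $A$ ($A$ homogeneous, non-pyramidal): a subconfiguration $I\subset A$ with a partition $I=I_1\cup\dots\cup I_p$ into nonempty subconfigurations such that (i) $I_1$ is a circuit; (ii) for $1\le j\le p-1$, with $L_j=L(I_1\cup\dots\cup I_j)$ and $\pi_j:L(I)\to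 L(I)/L_j$ the projection, either $\pi_j(I_{j+1})$ is a circuit of affine dimension $0$, or $\pi_j$ is injective on $I_{j+1}$ and $\pi_j(I_{j+1})$ is minimally linearly dependent. Put $$\eta(I)=d(I_1)+\sum_{j=1}^{p-1}d(\pi_j(I_{j+1})).$$ Supports: the support of $v\in\mathbb K^n$ is the $0/1$ vector in $\{0,1\}^n$ with ones at the positions where $v$ is nonzero; supports are ordered by inclusion. A maximal chain of (nonzero) supports of vectors in $\ker_{\mathbb K}(A)$ has the form $\underline\sigma=\{\sigma_1\prec\cdots\prec\sigma_{m(A)}\}$, and $M_{\underline\sigma}(A)$ is the matrix obtained by stacking the rows $\sigma_1,\dots,\sigma_{m(A)}$ below the matrix $A$. *)

theory Defs
  imports "HOL-Algebra.QuotRing" "Jordan_Normal_Form.DL_Rank" "Jordan_Normal_Form.Matrix_Kernel"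
begin

text \<open>
  A configuration in \<open>K\<^sup>e\<close> is the matrix \<open>A \<in> carrier_mat e n\<close> whose columns are its points, so
  repeated points are allowed; a subconfiguration is a set of column indices.  Dependence and affine
  dimension are also needed in quotient spaces, and are therefore defined for an arbitrary
  vector space \<open>V\<close> over \<open>class_ring\<close> and a finite family \<open>x\<close> of elements of \<open>V\<close> indexed by a
  set \<open>J\<close>.  All dependence is dependence of indexed families, not of the underlying point sets.
\<close>

definition comb :: "('k::field, 'v) module \<Rightarrow> ('i \<Rightarrow> 'v) \<Rightarrow> 'i set \<Rightarrow> ('i \<Rightarrow> 'k) \<Rightarrow> 'v" where
  "comb V x J c = (\<Oplus>\<^bsub>V\<^esub>i\<in>J. c i \<odot>\<^bsub>V\<^esub> x i)"

definition lin_dependent :: "('k::field, 'v) module \<Rightarrow> ('i \<Rightarrow> 'v) \<Rightarrow> 'i set \<Rightarrow> bool" where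
  "lin_dependent V x J \<longleftrightarrow> (\<exists>c. (\<exists>i\<in>J. c i \<noteq> 0) \<and> comb V x J c = \<zero>\<^bsub>V\<^esub>)"

definition aff_dependent :: "('k::field, 'v) module \<Rightarrow> ('i \<Rightarrow> 'v) \<Rightarrow> 'i set \<Rightarrow> bool" where
  "aff_dependent V x J \<longleftrightarrow>
     (\<exists>c. (\<exists>i\<in>J. c i \<noteq> 0) \<and> (\<Sum>i\<in>J. c i) = 0 \<and> comb V x J c = \<zero>\<^bsub>V\<^esub>)"

definition min_lin_dependent :: "('k::field, 'v) module \<Rightarrow> ('i \<Rightarrow> 'v) \<Rightarrow> 'i set \<Rightarrow> bool" where
  "min_lin_dependent V x J \<longleftrightarrow> lin_dependent V x J \<and> (\<forall>J'. J' \<subset> J \<longrightarrow> \<not> lin_dependent V x J')"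

definition circuit :: "('k::field, 'v) module \<Rightarrow> ('i \<Rightarrow> 'v) \<Rightarrow> 'i set \<Rightarrow> bool" where
  "circuit V x J \<longleftrightarrow> aff_dependent V x J \<and> (\<forall>J'. J' \<subset> J \<longrightarrow> \<not> aff_dependent V x J')"

definition lin_span :: "('k::field, 'v) module \<Rightarrow> ('i \<Rightarrow> 'v) \<Rightarrow> 'i set \<Rightarrow> 'v set" where
  "lin_span V x J = LinearCombinations.module.span class_ring V (x ` J)"

definition aff_span :: "('k::field, 'v) module \<Rightarrow> ('i \<Rightarrow> 'v) \<Rightarrow> 'i set \<Rightarrow> 'v set" where
  "aff_span V x J = {comb V x J c | c. (\<Sum>i\<in>J. c i) = 1}"

text \<open>
  The dimension of an affine subspace is that of its space of directions, and \<open>-1\<close> if it is empty.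
\<close>

definition aff_dim :: "('k::field, 'v) module \<Rightarrow> ('i \<Rightarrow> 'v) \<Rightarrow> 'i set \<Rightarrow> int" where
  "aff_dim V x J =
     (if J = {} then -1
      else int (vectorspace.dim class_ring
        (V\<lparr>carrier := {p \<ominus>\<^bsub>V\<^esub> q | p q. p \<in> aff_span V x J \<and> q \<in> aff_span V x J}\<rparr>)))"

text \<open>The quotient of a module by a submodule, on cosets, in the style of \<^const>\<open>FactRing\<close>.\<close>

definition quot_space :: "('k, 'v) module \<Rightarrow> 'v set \<Rightarrow> ('k, 'v set) module" where
  "quot_space V L =
     \<lparr>carrier = a_rcosets\<^bsub>V\<^esub> L, mult = undefined, one = undefined,
      zero = L, add = set_add V,
      smult = (\<lambda>c X. \<Union>v\<in>X. L +>\<^bsub>V\<^esub> (c \<odot>\<^bsub>V\<^esub> v))\<rparr>"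

definition quot_proj :: "('k, 'v) module \<Rightarrow> 'v set \<Rightarrow> 'v \<Rightarrow> 'v set" where
  "quot_proj V L v = L +>\<^bsub>V\<^esub> v"

abbreviation ambient :: "'k::field mat \<Rightarrow> ('k, 'k vec) module" where
  "ambient A \<equiv> module_vec TYPE('k) (dim_row A)"

definition config_dim :: "'k::field mat \<Rightarrow> int" where
  "config_dim A = aff_dim (ambient A) (col A) {..<dim_col A}"

definition homogeneous :: "'k::field mat \<Rightarrow> bool" where
  "homogeneous A \<longleftrightarrow> vec (dim_col A) (\<lambda>_. 1) \<in> vec_space.row_space (dim_col A) A"

definition affine_hyperplane :: "nat \<Rightarrow> 'k::field vec set \<Rightarrow> bool" where
  "affine_hyperplane e H \<longleftrightarrow>
     (\<exists>w\<in>carrier_vec e. \<exists>b. w \<noteq> 0\<^sub>v e \<and> H = {v \<in> carrier_vec e. w \<bullet> v = b})"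

definition pyramid :: "'k::field mat \<Rightarrow> bool" where
  "pyramid A \<longleftrightarrow>
     (\<exists>H. affine_hyperplane (dim_row A) H \<and>
       (\<exists>i<dim_col A. col A i \<notin> H \<and> (\<forall>j<dim_col A. j \<noteq> i \<longrightarrow> col A j \<in> H)))"

text \<open>
  An iterated circuit is given by the list \<open>[I\<^sub>1, \<dots>, I\<^sub>p]\<close> of the blocks of its ordered
  partition.  Lists are indexed from \<open>0\<close>, so \<open>Is ! j\<close> is \<open>I\<^bsub>j+1\<^esub>\<close>, and
  \<open>\<Union>(set (take j Is))\<close> is \<open>I\<^sub>1 \<union> \<dots> \<union> I\<^sub>j\<close>.
\<close>

definition ic_space :: "'k::field mat \<Rightarrow> nat set list \<Rightarrow> ('k, 'k vec) module" where
  "ic_space A Is = (ambient A)\<lparr>carrier := lin_span (ambient A) (col A) (\<Union>(set Is))\<rparr>"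

definition ic_sub :: "'k::field mat \<Rightarrow> nat set list \<Rightarrow> nat \<Rightarrow> 'k vec set" where
  "ic_sub A Is j = lin_span (ambient A) (col A) (\<Union>(set (take j Is)))"

definition ic_quot :: "'k::field mat \<Rightarrow> nat set list \<Rightarrow> nat \<Rightarrow> ('k, 'k vec set) module" where
  "ic_quot A Is j = quot_space (ic_space A Is) (ic_sub A Is j)"

text \<open>The family of the projected points \<open>\<pi>\<^sub>j a\<^sub>i\<close>:\<close>

definition ic_proj :: "'k::field mat \<Rightarrow> nat set list \<Rightarrow> nat \<Rightarrow> nat \<Rightarrow> 'k vec set" where
  "ic_proj A Is j i = quot_proj (ic_space A Is) (ic_sub A Is j) (col A i)"

definition iterated_circuit :: "'k::field mat \<Rightarrow> nat set list \<Rightarrow> bool" where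
  "iterated_circuit A Is \<longleftrightarrow>
     Is \<noteq> [] \<and> {} \<notin> set Is \<and> \<Union>(set Is) \<subseteq> {..<dim_col A} \<and>
     (\<forall>i j. i < j \<and> j < length Is \<longrightarrow> Is ! i \<inter> Is ! j = {}) \<and>
     circuit (ambient A) (col A) (Is ! 0) \<and>
     (\<forall>j\<in>{1..<length Is}.
        circuit (ic_quot A Is j) (ic_proj A Is j) (Is ! j) \<and>
          aff_dim (ic_quot A Is j) (ic_proj A Is j) (Is ! j) = 0
        \<or> inj_on (ic_proj A Is j) (Is ! j) \<and>
          min_lin_dependent (ic_quot A Is j) (ic_proj A Is j) (Is ! j))"

definition eta :: "'k::field mat \<Rightarrow> nat set list \<Rightarrow> int" where
  "eta A Is = aff_dim (ambient A) (col A) (Is ! 0) +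
     (\<Sum>j = 1..<length Is. aff_dim (ic_quot A Is j) (ic_proj A Is j) (Is ! j))"

definition iota :: "'k::field mat \<Rightarrow> int" where
  "iota A = Max {eta A Is | Is. iterated_circuit A Is}"

definition support_vec :: "'k::field vec \<Rightarrow> 'k vec" where
  "support_vec v = vec (dim_vec v) (\<lambda>i. if v $ i \<noteq> 0 then 1 else 0)"

definition support_less :: "'k::field vec \<Rightarrow> 'k vec \<Rightarrow> bool" where
  "support_less s t \<longleftrightarrow>
     {i. i < dim_vec s \<and> s $ i \<noteq> 0} \<subset> {i. i < dim_vec t \<and> t $ i \<noteq> 0}"

definition ker_supports :: "'k::field mat \<Rightarrow> 'k vec set" where
  "ker_supports A = {support_vec v | v. v \<in> mat_kernel A \<and> v \<noteq> 0\<^sub>v (dim_col A)}"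

text \<open>
  A maximal chain, listed increasingly.  Its length is not prescribed: only maximality among the
  chains of nonzero supports is required.
\<close>

definition maximal_support_chain :: "'k::field mat \<Rightarrow> 'k vec list \<Rightarrow> bool" where
  "maximal_support_chain A ss \<longleftrightarrow>
     sorted_wrt support_less ss \<and> pred_on.maxchain (ker_supports A) support_less (set ss)"

definition chain_matrix :: "'k::field mat \<Rightarrow> 'k vec list \<Rightarrow> 'k mat" where
  "chain_matrix A ss = A @\<^sub>r mat_of_rows (dim_col A) ss"

definition rho :: "'k::field mat \<Rightarrow> nat" where
  "rho A = Max {vec_space.rank (dim_row (chain_matrix A ss)) (chain_matrix A ss) | ss.
                  maximal_support_chain A ss}"

end

theory Submission
  imports Defs
begin

text \<open>
  Let \<open>K\<close> be the kernel of \<open>A\<close>, and for a set \<open>S\<close> of columns let \<open>K\<^sub>S\<close> consist of the vectors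
  of \<open>K\<close> supported in \<open>S\<close>.  Homogeneity makes the coordinates of every vector of \<open>K\<close> sum to
  zero, and since \<open>A\<close> is no pyramid, no coordinate vanishes on all of \<open>K\<close>
  (\<open>homogeneous_kernel_sum_zero\<close>, \<open>not_pyramid_kernel_full\<close>).

  Call a support of a vector of \<open>K\<close> a cyclic set.  The field is infinite, so cyclic sets are
  closed under union, and if the cyclic set \<open>T\<close> covers the cyclic set \<open>S\<close>, then \<open>K\<^sub>S\<close> is the
  hyperplane of \<open>K\<^sub>T\<close> cut out by any one coordinate in \<open>T - S\<close>.  Hence the maximal chains of
  supports are the saturated chains from the empty set to the set of all columns, here called
  flags, and all of them have \<open>dim K = n - d - 1\<close> members.  A covering step from \<open>S\<close> to \<open>T\<close> is
  called affine if the coordinate sum over \<open>T - S\<close> vanishes on \<open>K\<^sub>T\<close>.  Let \<open>a\<close> be the least number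
  of affine steps in a flag.  Both sides of the equation are equal to \<open>a - 1\<close>.

  Ranks: by rank-nullity, \<open>n\<close> minus the rank of a chain matrix is the dimension of the space \<open>N\<close>
  of those vectors of \<open>K\<close> whose coordinates sum to zero over every member of the chain.  Going down a
  flag, \<open>N\<close> can lose a dimension only at an affine step (\<open>dim_balanced_le_affine_steps\<close>), so the
  rank is at least \<open>n\<close> minus the number of affine steps.  The inequality can be strict,
  but every chain can be traded for a flag with at most \<open>dim N\<close> affine steps
  (\<open>flag_affine_steps_le_dim_balanced\<close>).  To find it, take the largest member \<open>S\<close> of the chain
  whose sum functional is nonzero on \<open>K\<^sub>T\<close>, where \<open>T\<close> is the set of all columns.  The
  complement \<open>T - S\<close> is a disjoint union of sets \<open>T - R\<close>, where \<open>T\<close> covers \<open>R\<close> and \<open>S \<subseteq> R\<close>; so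
  one of these steps from \<open>R\<close> to \<open>T\<close> is not affine.  Use it as the top step of the new flag and
  continue in \<open>R\<close> with the members of the chain contained in \<open>S\<close>; the discarded members impose no
  condition on \<open>K\<^sub>T\<close>, so the space \<open>N\<close> does not grow.  If there is no such \<open>S\<close>, then \<open>N = K\<^sub>T\<close>, whose
  dimension is the number of all steps of any flag.

  Iterated circuits: a linear relation between the projections of the points of a block modulo the
  span of the earlier blocks is a vector of \<open>K\<close> supported in the blocks up to this one.  Therefore a
  block is minimally dependent modulo the union \<open>W\<close> of the earlier blocks if and only if its
  union with \<open>W\<close> covers \<open>W\<close>, and its affine dimension is then its size minus one, and one less
  if the step is affine (\<open>min_lin_dependent_iff\<close>, \<open>aff_dim_covers\<close>).  So the successive
  differences of a flag form an iterated circuit whose \<open>\<eta>\<close> is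
  \<open>n - dim K\<close> minus the number of affine steps.  Conversely every iterated circuit refines and
  extends to a flag without decreasing this quantity, since a covering step never contributes a
  negative amount (\<open>flag_score_step\<close>).  So the maximum of \<open>\<eta>\<close> is \<open>d + 1 - a\<close>.
\<close>

section \<open>Subspaces of coordinate space and their dimension\<close>

abbreviation lin_subspace :: "nat \<Rightarrow> 'k::field vec set \<Rightarrow> bool" where
  "lin_subspace n U \<equiv> submodule class_ring U (module_vec TYPE('k) n)"

abbreviation subspace_dim :: "nat \<Rightarrow> 'k::field vec set \<Rightarrow> nat" where
  "subspace_dim n U \<equiv> vectorspace.dim class_ring ((module_vec TYPE('k) n)\<lparr>carrier := U\<rparr>)"

lemma lin_subspace_iff:
  fixes U :: "'k::field vec set"
  shows "lin_subspace n U \<longleftrightarrow> U \<subseteq> carrier_vec n \<and> 0\<^sub>v n \<in> U \<and>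
    (\<forall>v\<in>U. \<forall>w\<in>U. v + w \<in> U) \<and> (\<forall>c. \<forall>v\<in>U. c \<cdot>\<^sub>v v \<in> U)"
proof -
  interpret V: vec_space "TYPE('k)" n .
  show ?thesis
    unfolding submodule_def using V.module_axioms by auto
qed

lemma lin_subspaceD:
  fixes U :: "'k::field vec set"
  assumes "lin_subspace n U"
  shows "v \<in> U \<Longrightarrow> v \<in> carrier_vec n" "0\<^sub>v n \<in> U"
    "v \<in> U \<Longrightarrow> w \<in> U \<Longrightarrow> v + w \<in> U" "v \<in> U \<Longrightarrow> c \<cdot>\<^sub>v v \<in> U"
  using assms unfolding lin_subspace_iff by auto

lemma lin_subspace_restrict:
  fixes U :: "'k::field vec set"
  assumes "lin_subspace n U"
    and "\<And>v w. v \<in> U \<Longrightarrow> w \<in> U \<Longrightarrow> f (v + w) = f v + f w"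
    and "\<And>c v. v \<in> U \<Longrightarrow> f (c \<cdot>\<^sub>v v) = c * f v"
  shows "lin_subspace n {v \<in> U. f v = (0::'k)}"
proof -
  have "f (0\<^sub>v n) = 0"
    using assms(3)[of "0\<^sub>v n" 0] lin_subspaceD(2)[OF assms(1)] by (simp add: smult_vec_def zero_vec_def)
  then show ?thesis
    using assms unfolding lin_subspace_iff by auto
qed

lemma vectorspace_lin_subspace:
  fixes U :: "'k::field vec set"
  assumes "lin_subspace n U"
  shows "vectorspace class_ring ((module_vec TYPE('k) n)\<lparr>carrier := U\<rparr>)"
proof -
  interpret V: vec_space "TYPE('k)" n .
  show ?thesis
    using V.subspace_is_vs[of U] assms V.vectorspace_axioms by (simp add: VectorSpace.subspace_def)
qed

lemma fin_dim_lin_subspace: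
  fixes U :: "'k::field vec set"
  assumes U: "lin_subspace n U"
  shows "vectorspace.fin_dim class_ring ((module_vec TYPE('k) n)\<lparr>carrier := U\<rparr>)"
proof -
  interpret V: vec_space "TYPE('k)" n .
  interpret W: vectorspace class_ring "V.V\<lparr>carrier := U\<rparr>"
    by (rule vectorspace_lin_subspace[OF U])
  have Uc: "U \<subseteq> carrier_vec n" using U unfolding lin_subspace_iff by auto
  have "\<exists>B. finite B \<and> maximal B (\<lambda>S. S \<subseteq> carrier (V.V\<lparr>carrier := U\<rparr>) \<and> W.lin_indpt S)"
  proof (rule maximal_exists[where N = n and B = "{}"])
    fix S assume S: "S \<subseteq> carrier (V.V\<lparr>carrier := U\<rparr>) \<and> W.lin_indpt S"
    then have "V.lin_indpt S"
      using V.span_li_not_depend(2)[of S U] U by auto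
    then show "finite S \<and> card S \<le> n"
      using V.li_le_dim[of S] V.fin_dim V.dim_is_n S Uc by auto
  next
    show "{} \<subseteq> carrier (V.V\<lparr>carrier := U\<rparr>) \<and> W.lin_indpt {}"
      by (auto simp: W.lin_dep_def)
  qed
  then obtain B where "finite B" "W.basis B"
    using W.max_li_is_basis by auto
  then show ?thesis
    unfolding W.fin_dim_def W.basis_def by auto
qed

text \<open>
  The codomain is an arbitrary vector space because affine dimensions are taken in quotients of
  coordinate space.
\<close>

lemma rank_nullity_lin_subspace:
  fixes U :: "'k::field vec set" and V :: "('k, 'v) module"
  assumes U: "lin_subspace n U" and V: "vectorspace class_ring V"
    and car: "\<And>v. v \<in> U \<Longrightarrow> f v \<in> carrier V"
    and add: "\<And>v w. v \<in> U \<Longrightarrow> w \<in> U \<Longrightarrow> f (v + w) = f v \<oplus>\<^bsub>V\<^esub> f w"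
    and smult: "\<And>c v. v \<in> U \<Longrightarrow> f (c \<cdot>\<^sub>v v) = c \<odot>\<^bsub>V\<^esub> f v"
  shows "vectorspace.dim class_ring (V\<lparr>carrier := f ` U\<rparr>)
           + subspace_dim n {v \<in> U. f v = \<zero>\<^bsub>V\<^esub>} = subspace_dim n U"
proof -
  let ?U = "(module_vec TYPE('k) n)\<lparr>carrier := U\<rparr>"
  have Uv: "vectorspace class_ring ?U" by (rule vectorspace_lin_subspace[OF U])
  have "f \<in> LinearCombinations.module_hom class_ring ?U V"
    unfolding LinearCombinations.module_hom_def using car add smult by (auto simp: module_vec_simps)
  then have mh: "mod_hom class_ring ?U V f"
    using Uv V by (auto simp: mod_hom_def mod_hom_axioms_def vectorspace_def)
  then have lm: "linear_map class_ring ?U V f"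
    using Uv V by (auto simp: linear_map_def)
  have "mod_hom.im ?U f = f ` U" "mod_hom.ker ?U V f = {v \<in> U. f v = \<zero>\<^bsub>V\<^esub>}"
    by (auto simp: mod_hom.im_def[OF mh] mod_hom.ker_def[OF mh])
  then show ?thesis
    using linear_map.rank_nullity[OF lm fin_dim_lin_subspace[OF U]] by simp
qed

lemma subspace_dim_zero [simp]: "subspace_dim n {0\<^sub>v n :: 'k::field vec} = 0"
proof -
  have "lin_subspace n {0\<^sub>v n :: 'k vec}" unfolding lin_subspace_iff by auto
  then interpret W: vectorspace class_ring "(module_vec TYPE('k) n)\<lparr>carrier := {0\<^sub>v n}\<rparr>"
    by (rule vectorspace_lin_subspace)
  show ?thesis
  proof (rule W.dim0I)
    have "W.span {0\<^sub>v n} \<subseteq> {0\<^sub>v n}" using W.span_is_subset2[of "{0\<^sub>v n}"] by simp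
    moreover have "0\<^sub>v n \<in> W.span {0\<^sub>v n}" using W.span_zero by (simp add: module_vec_simps)
    ultimately show "W.gen_set {\<zero>\<^bsub>(module_vec TYPE('k) n)\<lparr>carrier := {0\<^sub>v n}\<rparr>\<^esub>}"
      by (auto simp: module_vec_simps)
  qed
qed

text \<open>
  Most dimensions below are computed by cutting with one linear functional at a time.
\<close>

lemma subspace_dim_functional:
  fixes U :: "'k::field vec set" and f :: "'k vec \<Rightarrow> 'k"
  assumes U: "lin_subspace n U"
    and add: "\<And>v w. v \<in> U \<Longrightarrow> w \<in> U \<Longrightarrow> f (v + w) = f v + f w"
    and smult: "\<And>c v. v \<in> U \<Longrightarrow> f (c \<cdot>\<^sub>v v) = c * f v"
  shows "subspace_dim n U =
    subspace_dim n {v \<in> U. f v = 0} + (if \<exists>v\<in>U. f v \<noteq> 0 then 1 else 0)"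
proof -
  let ?g = "\<lambda>v. vec 1 (\<lambda>_. f v)"
  interpret V: vec_space "TYPE('k)" 1 .
  have eq: "?g v = 0\<^sub>v 1 \<longleftrightarrow> f v = 0" for v
    by (auto simp: vec_eq_iff)
  have "vectorspace.dim class_ring (V.V\<lparr>carrier := ?g ` U\<rparr>)
      + subspace_dim n {v \<in> U. ?g v = \<zero>\<^bsub>V.V\<^esub>} = subspace_dim n U"
    using V.vectorspace_axioms add smult
    by (intro rank_nullity_lin_subspace[OF U]) (auto simp: module_vec_simps vec_eq_iff)
  moreover have "vectorspace.dim class_ring (V.V\<lparr>carrier := ?g ` U\<rparr>)
     = (if \<exists>v\<in>U. f v \<noteq> 0 then 1 else 0)"
  proof (cases "\<exists>v\<in>U. f v \<noteq> 0")
    case True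
    then obtain v where v: "v \<in> U" "f v \<noteq> 0" by auto
    have "?g ` U = carrier_vec 1"
    proof (intro equalityI subsetI)
      fix x :: "'k vec" assume "x \<in> carrier_vec 1"
      then have "x = ?g ((x $ 0 / f v) \<cdot>\<^sub>v v)"
        using v smult by (auto simp: vec_eq_iff)
      then show "x \<in> ?g ` U" using lin_subspaceD(4)[OF U v(1)] by blast
    qed auto
    moreover have "V.V\<lparr>carrier := carrier_vec 1\<rparr> = V.V"
      by (simp add: module_vec_def)
    ultimately show ?thesis using True V.dim_is_n by simp
  next
    case False
    then have "?g v = 0\<^sub>v 1" if "v \<in> U" for v
      using that eq by blast
    then have "?g ` U = {0\<^sub>v 1}"
      using lin_subspaceD(2)[OF U] by (metis (no_types, lifting) image_cong image_constant)
    then show ?thesis using False by simp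
  qed
  moreover have "{v \<in> U. ?g v = \<zero>\<^bsub>V.V\<^esub>} = {v \<in> U. f v = 0}"
    using eq by (auto simp: module_vec_simps)
  ultimately show ?thesis by (subst add.commute) (simp only:)
qed

lemma subspace_dim_coordinate:
  fixes U :: "'k::field vec set"
  assumes U: "lin_subspace n U" and i: "i < n"
  shows "lin_subspace n {v \<in> U. v $ i = 0}"
    and "subspace_dim n U =
      subspace_dim n {v \<in> U. v $ i = 0} + (if \<exists>v\<in>U. v $ i \<noteq> 0 then 1 else 0)"
proof -
  have add: "(v + w) $ i = v $ i + w $ i" if "v \<in> U" "w \<in> U" for v w
    using lin_subspaceD(1)[OF U that(1)] lin_subspaceD(1)[OF U that(2)] i by simp
  have smult: "(c \<cdot>\<^sub>v v) $ i = c * v $ i" if "v \<in> U" for c v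
    using lin_subspaceD(1)[OF U that] i by simp
  show "lin_subspace n {v \<in> U. v $ i = 0}"
    by (rule lin_subspace_restrict[OF U add smult])
  show "subspace_dim n U =
      subspace_dim n {v \<in> U. v $ i = 0} + (if \<exists>v\<in>U. v $ i \<noteq> 0 then 1 else 0)"
    by (rule subspace_dim_functional[OF U add smult])
qed

text \<open>
  Cutting both spaces by the coordinates one after the other, the smaller space never loses a
  dimension at a coordinate where the larger one does not.
\<close>

lemma subspace_dim_mono:
  fixes U W :: "'k::field vec set"
  assumes "lin_subspace n U" "lin_subspace n W" "U \<subseteq> W"
  shows "subspace_dim n U \<le> subspace_dim n W"
proof -
  have "subspace_dim n U \<le> subspace_dim n W"
    if "k \<le> n" "lin_subspace n U" "lin_subspace n W" "U \<subseteq> W"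
      "\<And>v i. v \<in> W \<Longrightarrow> k \<le> i \<Longrightarrow> i < n \<Longrightarrow> v $ i = 0" for k and U W :: "'k vec set"
    using that
  proof (induction k arbitrary: U W)
    case 0
    then have "v = 0\<^sub>v n" if "v \<in> W" for v
      using lin_subspaceD(1)[OF 0(3) that] that by (auto simp: vec_eq_iff)
    then have "U = {0\<^sub>v n}"
      using 0(4) lin_subspaceD(2)[OF 0(2)] by auto
    then show ?case by simp
  next
    case (Suc k)
    let ?cut = "\<lambda>X. {v \<in> X. v $ k = 0} :: 'k vec set"
    have "subspace_dim n (?cut U) \<le> subspace_dim n (?cut W)"
    proof (rule Suc.IH)
      show "v $ i = 0" if "v \<in> ?cut W" "k \<le> i" "i < n" for v i
        using that Suc.prems(5)[of v i] by (cases "i = k") auto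
      show "lin_subspace n (?cut U)" "lin_subspace n (?cut W)"
        by (rule subspace_dim_coordinate(1), use Suc.prems in auto)+
    qed (use Suc.prems in auto)
    moreover have "(if \<exists>v\<in>U. v $ k \<noteq> 0 then 1 else 0) \<le> (if \<exists>v\<in>W. v $ k \<noteq> 0 then 1 else (0::nat))"
      using Suc.prems(4) by (simp split: if_split) blast
    moreover have "k < n" using Suc.prems(1) by simp
    ultimately show ?case
      unfolding subspace_dim_coordinate(2)[OF Suc.prems(2) \<open>k < n\<close>]
        subspace_dim_coordinate(2)[OF Suc.prems(3) \<open>k < n\<close>] by (intro add_mono)
  qed
  from this[OF order_refl assms] show ?thesis by simp
qed

definition coord_sum :: "nat set \<Rightarrow> 'k::field vec \<Rightarrow> 'k" where
  "coord_sum S v = (\<Sum>i\<in>S. v $ i)"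

lemma coord_sum_add:
  "v \<in> carrier_vec n \<Longrightarrow> w \<in> carrier_vec n \<Longrightarrow> S \<subseteq> {..<n} \<Longrightarrow>
    coord_sum S (v + w) = coord_sum S v + coord_sum S w"
  unfolding coord_sum_def sum.distrib[symmetric] by (intro sum.cong) auto

lemma coord_sum_smult:
  "v \<in> carrier_vec n \<Longrightarrow> S \<subseteq> {..<n} \<Longrightarrow> coord_sum S (c \<cdot>\<^sub>v v) = c * coord_sum S v"
  unfolding coord_sum_def sum_distrib_left by (intro sum.cong) auto

lemma lin_subspace_coord_sum:
  fixes U :: "'k::field vec set"
  assumes U: "lin_subspace n U" and S: "S \<subseteq> {..<n}"
  shows "lin_subspace n {v \<in> U. coord_sum S v = 0}"
proof (rule lin_subspace_restrict[OF U])
  show "coord_sum S (v + w) = coord_sum S v + coord_sum S w" if "v \<in> U" "w \<in> U" for v w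
    using that S lin_subspaceD(1)[OF U] by (intro coord_sum_add)
  show "coord_sum S (c \<cdot>\<^sub>v v) = c * coord_sum S v" if "v \<in> U" for c v
    using that S lin_subspaceD(1)[OF U] by (intro coord_sum_smult)
qed

definition supp :: "'k::zero vec \<Rightarrow> nat set" where
  "supp v = {i. i < dim_vec v \<and> v $ i \<noteq> 0}"

lemma supp_zero [simp]: "supp (0\<^sub>v n :: 'k::zero vec) = {}"
  by (auto simp: supp_def)

lemma subspace_dim_support:
  assumes "J \<subseteq> {..<n}"
  shows "lin_subspace n {v \<in> carrier_vec n :: 'k::field vec set. supp v \<subseteq> J}"
    and "subspace_dim n {v \<in> carrier_vec n :: 'k vec set. supp v \<subseteq> J} = card J"
proof -
  have sub: "lin_subspace n {v \<in> carrier_vec n :: 'k vec set. supp v \<subseteq> J}" for J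
    unfolding lin_subspace_iff supp_def by (auto simp: subset_iff)
  show "lin_subspace n {v \<in> carrier_vec n :: 'k vec set. supp v \<subseteq> J}" by (rule sub)
  have "finite J" using assms finite_subset by blast
  then show "subspace_dim n {v \<in> carrier_vec n :: 'k vec set. supp v \<subseteq> J} = card J"
    using assms
  proof (induction J rule: finite_induct)
    case empty
    have "{v \<in> carrier_vec n :: 'k vec set. supp v \<subseteq> {}} = {0\<^sub>v n}"
      by (auto simp: supp_def vec_eq_iff)
    then show ?case by simp
  next
    case (insert j J)
    have cut: "{v \<in> {v \<in> carrier_vec n :: 'k vec set. supp v \<subseteq> insert j J}. v $ j = 0}
        = {v \<in> carrier_vec n. supp v \<subseteq> J}"
      using insert by (auto simp: supp_def)
    have "unit_vec n j \<in> {v \<in> carrier_vec n :: 'k vec set. supp v \<subseteq> insert j J}"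
      "(unit_vec n j :: 'k vec) $ j \<noteq> 0"
      using insert.prems by (auto simp: supp_def unit_vec_def split: if_splits)
    then have ex: "\<exists>v\<in>{v \<in> carrier_vec n :: 'k vec set. supp v \<subseteq> insert j J}. v $ j \<noteq> 0"
      by blast
    have "j < n" using insert.prems by simp
    have "subspace_dim n {v \<in> carrier_vec n :: 'k vec set. supp v \<subseteq> insert j J}
        = subspace_dim n {v \<in> carrier_vec n :: 'k vec set. supp v \<subseteq> J} + 1"
      unfolding subspace_dim_coordinate(2)[OF sub[of "insert j J"] \<open>j < n\<close>] cut if_P[OF ex] ..
    then show ?case using insert by simp
  qed
qed

section \<open>Supports of vectors in a subspace\<close>

lemma supp_subset: "v \<in> carrier_vec n \<Longrightarrow> supp v \<subseteq> {..<n}"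
  by (auto simp: supp_def)

lemma supp_add: "v \<in> carrier_vec n \<Longrightarrow> w \<in> carrier_vec n \<Longrightarrow>
  supp (v + w :: 'k::field vec) \<subseteq> supp v \<union> supp w"
  by (auto simp: supp_def)

lemma supp_diff: "v \<in> carrier_vec n \<Longrightarrow> w \<in> carrier_vec n \<Longrightarrow>
  supp (v - w :: 'k::field vec) \<subseteq> supp v \<union> supp w"
  by (auto simp: supp_def)

lemma supp_smult: "supp (c \<cdot>\<^sub>v v :: 'k::field vec) \<subseteq> supp v"
  by (auto simp: supp_def)

lemma coord_sum_supp:
  assumes "v \<in> carrier_vec n" "supp v \<subseteq> S" "S \<subseteq> T" "T \<subseteq> {..<n}"
  shows "coord_sum T v = coord_sum S v"
  unfolding coord_sum_def using assms finite_subset[OF assms(4)]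
  by (intro sum.mono_neutral_right) (auto simp: supp_def)

lemma coord_sum_Diff:
  "finite T \<Longrightarrow> S \<subseteq> T \<Longrightarrow> coord_sum (T - S) v = coord_sum T v - coord_sum S v"
  unfolding coord_sum_def by (rule sum_diff)

text \<open>
  For all but finitely many scalars \<open>c\<close>, no coordinate cancels in \<open>v + c w\<close>.
\<close>

lemma supp_union_attained:
  fixes U :: "'k::field_char_0 vec set"
  assumes U: "lin_subspace n U" and v: "v \<in> U" and w: "w \<in> U"
  shows "\<exists>u\<in>U. supp u = supp v \<union> supp w"
proof -
  have car: "v \<in> carrier_vec n" "w \<in> carrier_vec n"
    using lin_subspaceD(1)[OF U] v w by auto
  have "\<not> UNIV \<subseteq> insert (0::'k) ((\<lambda>i. - v $ i / w $ i) ` {..<n})"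
    using infinite_UNIV_char_0[where 'a = 'k] finite_subset by blast
  \<comment> \<open>The excluded values are those at which some coordinate cancels; where \<open>w $ i = 0\<close>, the excluded value is 0.\<close>
  then obtain c where c: "c \<noteq> 0" "\<And>i. i < n \<Longrightarrow> c \<noteq> - v $ i / w $ i" by blast
  have "v $ i + c * w $ i \<noteq> 0" if "v $ i \<noteq> 0 \<or> w $ i \<noteq> 0" "i < n" for i
    using c(1) c(2)[OF that(2)] that(1)
    by (cases "w $ i = 0") (auto simp: field_simps add_eq_0_iff)
  then have "supp (v + c \<cdot>\<^sub>v w) = supp v \<union> supp w"
    using car by (auto simp: supp_def)
  then show ?thesis
    using lin_subspaceD(3,4)[OF U] v w by blast
qed

lemma generic_support_attained:
  fixes U :: "'k::field_char_0 vec set"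
  assumes U: "lin_subspace n U"
  shows "\<exists>u\<in>U. supp u = \<Union>(supp ` U)"
proof -
  have "F \<subseteq> \<Union>(supp ` U) \<Longrightarrow> \<exists>u\<in>U. F \<subseteq> supp u" if "finite F" for F
    using that
  proof (induction F rule: finite_induct)
    case empty
    then show ?case using lin_subspaceD(2)[OF U] by blast
  next
    case (insert i F)
    then obtain u v where "u \<in> U" "F \<subseteq> supp u" "v \<in> U" "i \<in> supp v" by auto
    then show ?case using supp_union_attained[OF U, of u v] by blast
  qed
  moreover have "finite (\<Union>(supp ` U))"
    by (rule finite_subset[of _ "{..<n}"]) (use supp_subset lin_subspaceD(1)[OF U] in blast)+
  ultimately show ?thesis by blast
qed

section \<open>Cyclic sets and flags\<close>

text \<open>
  The combinatorics depends on \<open>A\<close> only through its space of linear relations \<open>K\<close>: the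
  coordinates of each relation sum to zero, and every point takes part in some relation.
\<close>

locale relation_space =
  fixes n :: nat and K :: "'k::field_char_0 vec set"
  assumes subspace: "lin_subspace n K"
    and sum_zero: "v \<in> K \<Longrightarrow> coord_sum {..<n} v = 0"
    and full: "i < n \<Longrightarrow> \<exists>v\<in>K. v $ i \<noteq> 0"
begin

definition rel :: "nat set \<Rightarrow> 'k vec set" where
  "rel S = {v \<in> K. supp v \<subseteq> S}"

text \<open>
  In matroid terms: the unions of circuits of the configuration, or equivalently the
  complements of the flats of the dual matroid.  The empty set is included.
\<close>

definition cyclic :: "nat set \<Rightarrow> bool" where
  "cyclic S \<longleftrightarrow> (\<exists>v\<in>K. supp v = S)"

definition covers :: "nat set \<Rightarrow> nat set \<Rightarrow> bool" where
  "covers S T \<longleftrightarrow> cyclic S \<and> cyclic T \<and> S \<subset> T \<and> (\<forall>R. cyclic R \<longrightarrow> S \<subset> R \<longrightarrow> R \<subseteq> T \<longrightarrow> R = T)"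

definition affine_step :: "nat set \<Rightarrow> nat set \<Rightarrow> bool" where
  "affine_step S T \<longleftrightarrow> (\<forall>v\<in>rel T. coord_sum (T - S) v = 0)"

text \<open>
  A flag lists its nonempty members in decreasing order, so that it grows at the head; the empty
  set below its last member is implicit.  Its head may be any cyclic set, since flags are built step by step.
\<close>

fun flag_top :: "nat set list \<Rightarrow> nat set" where
  "flag_top [] = {}"
| "flag_top (T # Ts) = T"

inductive flag :: "nat set list \<Rightarrow> bool" where
  flag_Nil: "flag []"
| flag_Cons: "flag Ts \<Longrightarrow> covers (flag_top Ts) T \<Longrightarrow> flag (T # Ts)"

fun affine_steps :: "nat set list \<Rightarrow> nat" where
  "affine_steps [] = 0"
| "affine_steps (T # Ts) = affine_steps Ts + (if affine_step (flag_top Ts) T then 1 else 0)"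

lemma K_carrier: "v \<in> K \<Longrightarrow> v \<in> carrier_vec n"
  using lin_subspaceD(1)[OF subspace] .

lemma cyclic_subset: "cyclic S \<Longrightarrow> S \<subseteq> {..<n}"
  unfolding cyclic_def using supp_subset K_carrier by blast

lemma cyclic_finite: "cyclic S \<Longrightarrow> finite S"
  using cyclic_subset finite_subset by blast

lemma cyclic_empty: "cyclic {}"
  unfolding cyclic_def using lin_subspaceD(2)[OF subspace] supp_zero by blast

lemma rel_subspace: "lin_subspace n (rel S)"
  unfolding lin_subspace_iff
proof (intro conjI ballI allI subsetI)
  show "0\<^sub>v n \<in> rel S" using lin_subspaceD(2)[OF subspace] by (simp add: rel_def)
  show "v \<in> carrier_vec n" if "v \<in> rel S" for v
    using that K_carrier by (simp add: rel_def)
  show "v + w \<in> rel S" if "v \<in> rel S" "w \<in> rel S" for v w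
    using that lin_subspaceD(3)[OF subspace, of v w] supp_add[OF K_carrier K_carrier, of v w]
    by (auto simp: rel_def)
  show "c \<cdot>\<^sub>v v \<in> rel S" if "v \<in> rel S" for c v
    using that lin_subspaceD(4)[OF subspace, of v c] supp_smult[of c v]
    by (auto simp: rel_def)
qed

lemma rel_carrier: "v \<in> rel S \<Longrightarrow> v \<in> carrier_vec n"
  using K_carrier by (auto simp: rel_def)

lemma rel_mono: "S \<subseteq> T \<Longrightarrow> rel S \<subseteq> rel T"
  by (auto simp: rel_def)

lemma rel_empty: "rel {} = {0\<^sub>v n}"
proof -
  have "v = 0\<^sub>v n" if "v \<in> K" "supp v = {}" for v
    using that(2) carrier_vecD[OF K_carrier[OF that(1)]] by (auto simp: supp_def vec_eq_iff)
  moreover have "0\<^sub>v n \<in> rel {}"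
    using lin_subspaceD(2)[OF subspace] by (simp add: rel_def)
  ultimately show ?thesis unfolding rel_def by blast
qed

lemma rel_coord: "v \<in> rel S \<Longrightarrow> i < n \<Longrightarrow> i \<notin> S \<Longrightarrow> v $ i = 0"
  using carrier_vecD[OF rel_carrier, of v S] by (auto simp: rel_def supp_def)

lemma cyclic_generic: "lin_subspace n U \<Longrightarrow> U \<subseteq> K \<Longrightarrow> cyclic (\<Union>(supp ` U))"
  using generic_support_attained[of U n] unfolding cyclic_def by blast

lemma cyclic_Un: "cyclic S \<Longrightarrow> cyclic T \<Longrightarrow> cyclic (S \<union> T)"
  unfolding cyclic_def using supp_union_attained[OF subspace] by blast

lemma cyclic_UNIV: "cyclic {..<n}"
proof -
  have "\<Union>(supp ` K) = {..<n}"
  proof (intro equalityI subsetI)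
    fix i assume "i \<in> {..<n}"
    then obtain v where "v \<in> K" "v $ i \<noteq> 0" using full by auto
    then have "v \<in> K" "i \<in> supp v"
      using \<open>i \<in> {..<n}\<close> carrier_vecD[OF K_carrier, of v] by (auto simp: supp_def)
    then show "i \<in> \<Union>(supp ` K)" by blast
  qed (use supp_subset K_carrier in blast)
  then show ?thesis using cyclic_generic[OF subspace] by simp
qed

lemma rel_sum_zero:
  assumes "v \<in> rel T" "T \<subseteq> {..<n}"
  shows "coord_sum T v = 0"
  using coord_sum_supp[of v n T "{..<n}"] sum_zero[of v] assms rel_carrier by (auto simp: rel_def)

text \<open>
  Take a smallest cyclic set among those strictly above \<open>S\<close> and contained in \<open>T\<close>.
\<close>

lemma covers_exists:
  assumes "cyclic S" "cyclic T" "S \<subset> T"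
  shows "\<exists>R. covers S R \<and> R \<subseteq> T"
proof -
  let ?P = "\<lambda>R. cyclic R \<and> S \<subset> R \<and> R \<subseteq> T"
  obtain R where R: "?P R" "\<And>R'. ?P R' \<Longrightarrow> card R \<le> card R'"
    using assms ex_has_least_nat[of ?P T card] by blast
  have "R' = R" if "cyclic R'" "S \<subset> R'" "R' \<subseteq> R" for R'
    using R(2)[of R'] R(1) that cyclic_finite by (meson card_seteq order_trans)
  then show ?thesis using R(1) assms(1) unfolding covers_def by blast
qed

text \<open>
  If a relation on \<open>T\<close> vanishes at \<open>e\<close>, then the union of its support with \<open>S\<close> is a cyclic set
  that misses \<open>e\<close>, so it cannot be strictly larger than \<open>S\<close>.
\<close>

lemma rel_covers:
  assumes c: "covers S T" and e: "e \<in> T - S"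
  shows "rel S = {v \<in> rel T. v $ e = 0}"
proof (intro equalityI subsetI)
  have T: "T \<subseteq> {..<n}" using c cyclic_subset by (auto simp: covers_def)
  {
    fix v assume "v \<in> rel S"
    then show "v \<in> {v \<in> rel T. v $ e = 0}"
      using c e T rel_coord rel_mono[of S T] by (auto simp: covers_def)
  next
    fix v assume v: "v \<in> {v \<in> rel T. v $ e = 0}"
    then have "cyclic (S \<union> supp v)" "S \<union> supp v \<subseteq> T" "e \<notin> S \<union> supp v"
      using c e cyclic_Un by (auto simp: covers_def rel_def cyclic_def supp_def)
    then have "\<not> S \<subset> S \<union> supp v" using c e unfolding covers_def by blast
    then show "v \<in> rel S" using v by (auto simp: rel_def)
  }
qed

text \<open>
  Passing to the smaller member of a covering pair cuts \<open>rel\<close> by a single coordinate, which does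
  not vanish identically; so the dimension drops by exactly one in each step.
\<close>

lemma dim_flag:
  assumes "flag Ts"
  shows "subspace_dim n (rel (flag_top Ts)) = length Ts"
  using assms
proof (induction Ts)
  case flag_Nil
  then show ?case by (simp add: rel_empty)
next
  case (flag_Cons Ts T)
  then obtain e where e: "e \<in> T - flag_top Ts" by (auto simp: covers_def)
  have cyc: "cyclic T" using flag_Cons(2) by (simp add: covers_def)
  then obtain v where "v \<in> K" "supp v = T" by (auto simp: cyclic_def)
  then have ex: "\<exists>v\<in>rel T. v $ e \<noteq> 0" using e by (auto simp: rel_def supp_def)
  have "e < n" using e cyclic_subset[OF cyc] by auto
  then show ?case
    using subspace_dim_coordinate(2)[OF rel_subspace \<open>e < n\<close>, of T] ex flag_Cons.IH
    by (simp add: rel_covers[OF flag_Cons(2) e, symmetric])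
qed

lemma affine_steps_le: "affine_steps Ts \<le> length Ts"
  by (induction Ts) auto

lemma flag_top_cyclic: "flag Ts \<Longrightarrow> cyclic (flag_top Ts)"
  by (cases rule: flag.cases) (auto simp: cyclic_empty covers_def)

text \<open>
  For a flag reaching all columns, this turns out to be the \<open>\<eta>\<close> of the iterated circuit
  that the flag defines.
\<close>

definition flag_score :: "nat set list \<Rightarrow> int" where
  "flag_score Ts = int (card (flag_top Ts)) - int (length Ts) - int (affine_steps Ts)"

text \<open>
  The step contributes \<open>|T - S| - 1\<close>, reduced by one if it is affine.  An affine step has at
  least two elements: if \<open>T - S\<close> is a single point, its sum functional is a coordinate, and this is
  nonzero at a relation with support \<open>T\<close>.
\<close>

lemma flag_score_step:
  assumes "covers (flag_top Ts) T"
  shows "flag_score Ts \<le> flag_score (T # Ts)"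
proof -
  let ?S = "flag_top Ts"
  have T: "cyclic T" "?S \<subset> T" using assms by (auto simp: covers_def)
  have fin: "finite T" using T(1) cyclic_finite by blast
  then have card: "card T = card ?S + card (T - ?S)"
    using T(2) by (metis card_Diff_subset card_mono finite_subset le_add_diff_inverse psubset_imp_subset)
  have "card (T - ?S) \<noteq> 1" if aff: "affine_step ?S T"
  proof
    assume "card (T - ?S) = 1"
    then obtain e where e: "T - ?S = {e}" by (auto simp: card_1_singleton_iff)
    obtain v where v: "v \<in> K" "supp v = T" using T(1) by (auto simp: cyclic_def)
    then have "coord_sum {e} v = 0"
      using aff e by (auto simp: affine_step_def rel_def)
    then show False using e v(2) by (auto simp: coord_sum_def supp_def)
  qed
  moreover have "card (T - ?S) \<noteq> 0" using T(2) fin by auto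
  ultimately show ?thesis using card unfolding flag_score_def by auto
qed

lemma flag_extend:
  assumes "flag Ts" "cyclic T" "flag_top Ts \<subseteq> T"
  shows "\<exists>Ts'. flag Ts' \<and> flag_top Ts' = T \<and> flag_score Ts \<le> flag_score Ts'"
  using assms
proof (induction "card (T - flag_top Ts)" arbitrary: Ts rule: less_induct)
  case less
  show ?case
  proof (cases "flag_top Ts = T")
    case True
    then show ?thesis using less.prems by blast
  next
    case False
    then obtain R where R: "covers (flag_top Ts) R" "R \<subseteq> T"
      using covers_exists[of "flag_top Ts" T] less.prems flag_top_cyclic by blast
    have "T - R \<subset> T - flag_top Ts" using R less.prems(3) by (auto simp: covers_def)
    then have "card (T - flag_top (R # Ts)) < card (T - flag_top Ts)"
      using cyclic_finite[OF less.prems(2)] by (simp add: psubset_card_mono)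
    moreover have "flag (R # Ts)" using less.prems(1) R(1) by (rule flag.flag_Cons)
    ultimately obtain Ts' where "flag Ts'" "flag_top Ts' = T" "flag_score (R # Ts) \<le> flag_score Ts'"
      using less.hyps[of "R # Ts"] less.prems(2) R(2) by auto
    then show ?thesis using flag_score_step[OF R(1)] order_trans by blast
  qed
qed

section \<open>Balanced relations and affine steps\<close>

text \<open>
  If \<open>T\<close> is the set of all columns, this is the kernel of the chain matrix whose rows below \<open>A\<close>
  are the indicators of the members of \<open>C\<close>.
\<close>

definition balanced :: "nat set set \<Rightarrow> nat set \<Rightarrow> 'k vec set" where
  "balanced C T = {v \<in> rel T. \<forall>S\<in>C. coord_sum S v = 0}"

lemma balanced_subspace:
  assumes "\<And>S. S \<in> C \<Longrightarrow> S \<subseteq> {..<n}"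
  shows "lin_subspace n (balanced C T)"
proof -
  have "coord_sum S (0\<^sub>v n) = 0" if "S \<in> C" for S
    unfolding coord_sum_def using assms[OF that] by (intro sum.neutral) auto
  then show ?thesis
    unfolding lin_subspace_iff balanced_def
    using lin_subspaceD[OF rel_subspace[of T]] assms
    by (auto simp: coord_sum_add[of _ n] coord_sum_smult[of _ n])
qed

lemma flag_members:
  "flag Ts \<Longrightarrow> S \<in> set Ts \<Longrightarrow> cyclic S \<and> S \<noteq> {} \<and> S \<subseteq> flag_top Ts"
proof (induction Ts rule: flag.induct)
  case (flag_Cons Ts T)
  then show ?case by (cases "S = T") (auto simp: covers_def)
qed simp

text \<open>
  Modulo \<open>rel S\<close> the space \<open>rel T\<close> is a line, on which a single relation decides whether the
  sum over \<open>T - S\<close> vanishes.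
\<close>

lemma affine_step_witness:
  assumes c: "covers S T" and v: "v \<in> rel T" "coord_sum (T - S) v = 0" and e: "e \<in> T - S" "v $ e \<noteq> 0"
  shows "affine_step S T"
  unfolding affine_step_def
proof
  fix w assume w: "w \<in> rel T"
  have cT: "cyclic T" using c by (simp add: covers_def)
  then have en: "e < n" and sub: "T - S \<subseteq> {..<n}" using e(1) cyclic_subset by auto
  define u where "u = w + (- (w $ e / v $ e)) \<cdot>\<^sub>v v"
  have car: "w \<in> carrier_vec n" "v \<in> carrier_vec n" using w v(1) rel_carrier by auto
  have "u \<in> rel T" unfolding u_def using lin_subspaceD[OF rel_subspace] w v(1) by blast
  moreover have "u $ e = 0" unfolding u_def using car en e(2) by simp
  ultimately have "u \<in> rel S" using rel_covers[OF c e(1)] by simp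
  then have "coord_sum (T - S) u = 0"
    using rel_coord sub unfolding coord_sum_def by (intro sum.neutral) blast
  moreover have "coord_sum (T - S) u = coord_sum (T - S) w + (- (w $ e / v $ e)) * coord_sum (T - S) v"
    unfolding u_def using coord_sum_add[OF car(1) smult_carrier_vec[THEN iffD2, OF car(2)] sub]
      coord_sum_smult[OF car(2) sub] by metis
  ultimately show "coord_sum (T - S) w = 0" using v(2) by simp
qed

text \<open>
  A balanced relation that does not vanish on \<open>T - S\<close> has sum zero over \<open>T\<close> and over \<open>S\<close>, and
  therefore witnesses that the step from \<open>S\<close> to \<open>T\<close> is affine.
\<close>

lemma dim_balanced_le_affine_steps:
  assumes "flag Ts"
  shows "subspace_dim n (balanced (set Ts) (flag_top Ts)) \<le> affine_steps Ts"
  using assms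
proof (induction Ts)
  case flag_Nil
  then show ?case by (simp add: balanced_def rel_empty)
next
  case (flag_Cons Ts T)
  let ?S = "flag_top Ts" and ?N = "balanced (set (T # Ts)) T"
  have sub: "lin_subspace n (balanced (set Ts') T')" if "flag Ts'" for Ts' T'
    using flag_members[OF that] cyclic_subset by (intro balanced_subspace) blast
  have fl: "flag (T # Ts)" using flag_Cons flag.flag_Cons by blast
  obtain e where e: "e \<in> T - ?S" using flag_Cons(2) by (auto simp: covers_def)
  have cT: "cyclic T" and ST: "?S \<subseteq> T" using flag_Cons(2) by (auto simp: covers_def)
  then have en: "e < n" using e cyclic_subset by auto
  have cut: "{v \<in> ?N. v $ e = 0} \<subseteq> balanced (set Ts) ?S"
    unfolding balanced_def rel_covers[OF flag_Cons(2) e] by auto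
  have "subspace_dim n {v \<in> ?N. v $ e = 0} \<le> subspace_dim n (balanced (set Ts) ?S)"
    by (rule subspace_dim_mono[OF subspace_dim_coordinate(1)[OF sub[OF fl] en]
          sub[OF flag_Cons(1)] cut])
  moreover have "(if \<exists>v\<in>?N. v $ e \<noteq> 0 then 1 else 0) \<le> (if affine_step ?S T then 1 else (0::nat))"
  proof -
    have "affine_step ?S T" if v: "v \<in> ?N" "v $ e \<noteq> 0" for v
    proof (rule affine_step_witness[OF flag_Cons(2) _ _ e v(2)])
      have "coord_sum ?S v = 0"
        using v(1) by (cases Ts) (auto simp: balanced_def coord_sum_def)
      then show "coord_sum (T - ?S) v = 0"
        using v(1) ST by (simp add: coord_sum_Diff cyclic_finite[OF cT] balanced_def)
    qed (use v(1) in \<open>simp add: balanced_def\<close>)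
    then show ?thesis by auto
  qed
  moreover have "subspace_dim n ?N =
      subspace_dim n {v \<in> ?N. v $ e = 0} + (if \<exists>v\<in>?N. v $ e \<noteq> 0 then 1 else 0)"
    by (rule subspace_dim_coordinate(2)[OF sub[OF fl] en])
  ultimately show ?case using flag_Cons.IH by simp
qed

text \<open>
  The elements of \<open>T - R\<close> are those on which every relation vanishing at \<open>e\<close> vanishes, that is, the
  parallel class of \<open>e\<close> among the coordinate functionals on \<open>rel T\<close>.
\<close>

lemma covers_delete:
  assumes T: "cyclic T" and e: "e \<in> T"
  defines "R \<equiv> \<Union>(supp ` {v \<in> rel T. v $ e = 0})"
  shows "covers R T"
proof -
  have en: "e < n" using e cyclic_subset[OF T] by auto
  have "lin_subspace n {v \<in> rel T. v $ e = 0}"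
    by (rule subspace_dim_coordinate(1)[OF rel_subspace en])
  then have "cyclic R" unfolding R_def by (rule cyclic_generic) (auto simp: rel_def)
  moreover have "R \<subseteq> T" unfolding R_def by (auto simp: rel_def)
  moreover have "e \<notin> R" unfolding R_def by (auto simp: supp_def)
  moreover have "Q = T" if Q: "cyclic Q" "R \<subset> Q" "Q \<subseteq> T" for Q
  proof (rule ccontr)
    assume "Q \<noteq> T"
    then obtain f where f: "f \<in> T" "f \<notin> Q" using Q(3) by blast
    then have fn: "f < n" using cyclic_subset[OF T] by auto
    obtain q v where q: "q \<in> K" "supp q = Q" and v: "v \<in> K" "supp v = T"
      using Q(1) T by (auto simp: cyclic_def)
    have qv: "q \<in> rel T" "v \<in> rel T" using q v Q(3) by (auto simp: rel_def)
    have car: "q \<in> carrier_vec n" "v \<in> carrier_vec n" using q(1) v(1) K_carrier by auto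
    have "q $ e \<noteq> 0"
    proof
      assume "q $ e = 0"
      then have "Q \<subseteq> R" unfolding R_def using q(2) qv(1) by blast
      then show False using Q(2) by blast
    qed
    define u where "u = v + (- (v $ e / q $ e)) \<cdot>\<^sub>v q"
    have "u \<in> rel T" unfolding u_def using lin_subspaceD[OF rel_subspace] qv by blast
    moreover have "u $ e = 0" unfolding u_def using car en \<open>q $ e \<noteq> 0\<close> by simp
    moreover have "u $ f \<noteq> 0"
      unfolding u_def using car fn f q(2) v(2) by (auto simp: supp_def)
    moreover have "f < dim_vec u" unfolding u_def using car fn by simp
    ultimately have "f \<in> R" unfolding R_def by (auto simp: supp_def)
    then show False using f(2) Q(2) by blast
  qed
  ultimately show ?thesis using T e unfolding covers_def by blast
qed

text \<open>
  The parallel classes \<open>T - del e\<close> for \<open>e \<in> T - S\<close> partition \<open>T - S\<close>.  If the sum over each of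
  them vanished on \<open>rel T\<close>, then so would the sum over \<open>T - S\<close>.
\<close>

lemma nonaffine_covers_exists:
  assumes S: "cyclic S" "S \<subseteq> T" and T: "cyclic T"
    and w: "w \<in> rel T" "coord_sum (T - S) w \<noteq> 0"
  shows "\<exists>R. covers R T \<and> S \<subseteq> R \<and> \<not> affine_step R T"
proof (rule ccontr)
  assume no: "\<nexists>R. covers R T \<and> S \<subseteq> R \<and> \<not> affine_step R T"
  define del where "del e = \<Union>(supp ` {v \<in> rel T. v $ e = 0})" for e
  have cov: "covers (del e) T" if "e \<in> T" for e
    unfolding del_def using covers_delete[OF T that] .
  have self: "e \<notin> del e" for e by (auto simp: del_def supp_def)
  have sub: "S \<subseteq> del e" if "e \<in> T - S" for e
  proof -
    obtain s where "s \<in> K" "supp s = S" using S(1) by (auto simp: cyclic_def)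
    then have "s \<in> rel T" "s $ e = 0"
      using S(2) that cyclic_subset[OF T] carrier_vecD[OF K_carrier, of s]
      by (auto simp: rel_def supp_def)
    then show ?thesis unfolding del_def using \<open>supp s = S\<close> by blast
  qed
  have same: "del f = del e" if "e \<in> T" "f \<in> T" "f \<notin> del e" for e f
  proof -
    have "{v \<in> rel T. v $ f = 0} = {v \<in> rel T. v $ e = 0}"
      using rel_covers[OF cov[OF that(1)], of e] rel_covers[OF cov[OF that(1)], of f] that self
      by blast
    then show ?thesis by (simp add: del_def)
  qed
  have "coord_sum (T - S) w = (\<Sum>R\<in>del ` (T - S). \<Sum>x\<in>{x \<in> T - S. del x = R}. w $ x)"
    unfolding coord_sum_def using cyclic_finite[OF T] by (intro sum.group[symmetric]) auto
  also have "\<dots> = 0"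
  proof (rule sum.neutral, rule ballI)
    fix R assume "R \<in> del ` (T - S)"
    then obtain e where e: "e \<in> T - S" "R = del e" by blast
    have "{x \<in> T - S. del x = R} = T - R"
      using same[of e] sub[OF e(1)] self e by blast
    moreover have "affine_step R T" using no cov sub e by blast
    ultimately show "(\<Sum>x\<in>{x \<in> T - S. del x = R}. w $ x) = 0"
      using w(1) by (simp add: affine_step_def coord_sum_def)
  qed
  finally show False using w(2) by simp
qed

text \<open>
  This is the heart of the proof.  If some member of \<open>C\<close> has a sum that does not vanish on
  \<open>rel T\<close>, the largest such member \<open>S0\<close> lies below a lower cover \<open>R\<close> of \<open>T\<close> with a non-affine step,
  which costs nothing.  The members of \<open>C\<close> not contained in \<open>S0\<close> have sums that vanish on
  \<open>rel T\<close>, so dropping them when passing to \<open>R\<close> does not enlarge the space of balanced relations.  If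
  there is no such \<open>S0\<close>, every relation on \<open>T\<close> is balanced, and an arbitrary flag will do.
\<close>

lemma flag_affine_steps_le_dim_balanced:
  assumes "cyclic T" "finite C" "\<And>S. S \<in> C \<Longrightarrow> cyclic S \<and> S \<subseteq> T"
    and "\<And>S S'. S \<in> C \<Longrightarrow> S' \<in> C \<Longrightarrow> S \<subseteq> S' \<or> S' \<subseteq> S"
  shows "\<exists>Ts. flag Ts \<and> flag_top Ts = T \<and> affine_steps Ts \<le> subspace_dim n (balanced C T)"
  using assms
proof (induction "card T" arbitrary: T C rule: less_induct)
  case less
  note T = less.prems(1) and C = less.prems(2-4)
  let ?B = "{S \<in> C. \<exists>w\<in>rel T. coord_sum S w \<noteq> 0}"
  show ?case
  proof (cases "?B = {}")
    case True
    then have eq: "balanced C T = rel T" by (auto simp: balanced_def)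
    obtain Ts where Ts: "flag Ts" "flag_top Ts = T"
      using flag_extend[OF flag_Nil T] by auto
    then show ?thesis
      using dim_flag[OF Ts(1)] affine_steps_le[of Ts] unfolding eq by auto
  next
    case False
    have "finite ?B" using C(1) by simp
    then obtain S0 where S0: "S0 \<in> ?B" "\<And>S. S \<in> ?B \<Longrightarrow> S0 \<subseteq> S \<Longrightarrow> S = S0"
      using finite_has_maximal[of ?B] False by blast
    then obtain w where w: "w \<in> rel T" "coord_sum S0 w \<noteq> 0" by blast
    have S0T: "cyclic S0" "S0 \<subseteq> T" using S0(1) C(2) by auto
    have "coord_sum (T - S0) w \<noteq> 0"
      using w coord_sum_Diff[OF cyclic_finite[OF T] S0T(2), of w]
        rel_sum_zero[OF w(1) cyclic_subset[OF T]] by simp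
    then obtain R where R: "covers R T" "S0 \<subseteq> R" "\<not> affine_step R T"
      using nonaffine_covers_exists[OF S0T T w(1)] by blast
    have RT: "R \<subset> T" "cyclic R" using R(1) by (auto simp: covers_def)
    let ?C = "{S \<in> C. S \<subseteq> S0}"
    have "card R < card T" using RT(1) cyclic_finite[OF T] by (rule psubset_card_mono[rotated])
    then have "\<exists>Ts. flag Ts \<and> flag_top Ts = R \<and> affine_steps Ts \<le> subspace_dim n (balanced ?C R)"
    proof (rule less.hyps[OF _ RT(2)])
      show "finite ?C" using C(1) by simp
      show "cyclic S \<and> S \<subseteq> R" if "S \<in> ?C" for S using that C(2) R(2) by blast
      show "S \<subseteq> S' \<or> S' \<subseteq> S" if "S \<in> ?C" "S' \<in> ?C" for S S' using that C(3) by blast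
    qed
    then obtain Ts where Ts: "flag Ts" "flag_top Ts = R"
      "affine_steps Ts \<le> subspace_dim n (balanced ?C R)" by blast
    have "balanced ?C R \<subseteq> balanced C T"
    proof
      fix v assume v: "v \<in> balanced ?C R"
      then have vT: "v \<in> rel T" using rel_mono[of R T] RT(1) by (auto simp: balanced_def)
      have "coord_sum S v = 0" if S: "S \<in> C" for S
      proof (cases "S \<subseteq> S0")
        case True
        then show ?thesis using v S by (simp add: balanced_def)
      next
        case False
        then have "S \<notin> ?B" using S0 C(3)[OF S, of S0] by blast
        then show ?thesis using S vT by blast
      qed
      then show "v \<in> balanced C T" using vT by (simp add: balanced_def)
    qed
    then have "subspace_dim n (balanced ?C R) \<le> subspace_dim n (balanced C T)"
      by (intro subspace_dim_mono balanced_subspace) (use C(2) cyclic_subset in auto)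
    moreover have "flag (T # Ts)" using Ts R(1) by (auto intro: flag.flag_Cons)
    moreover have "affine_steps (T # Ts) = affine_steps Ts" using Ts(2) R(3) by simp
    ultimately show ?thesis using Ts(3) by (intro exI[of _ "T # Ts"]) auto
  qed
qed

end

section \<open>Ranks of the chain matrices\<close>

lemma rank_plus_kernel_dim:
  fixes M :: "'k::field mat"
  assumes M: "M \<in> carrier_mat r n"
  shows "lin_subspace n (mat_kernel M)"
    and "vec_space.rank r M + subspace_dim n (mat_kernel M) = n"
proof -
  interpret N: vec_space "TYPE('k)" n .
  interpret R: vec_space "TYPE('k)" r .
  have full: "lin_subspace n (carrier_vec n :: 'k vec set)"
    unfolding lin_subspace_iff by auto
  have "lin_subspace n {v \<in> carrier_vec n. M *\<^sub>v v = 0\<^sub>v r}"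
    unfolding lin_subspace_iff
    using M by (auto simp: mult_add_distrib_mat_vec[OF M] mult_mat_vec[OF M])
  then show "lin_subspace n (mat_kernel M)"
    unfolding mat_kernel[OF M] by simp
  have "vectorspace.dim class_ring (R.V\<lparr>carrier := (\<lambda>v. M *\<^sub>v v) ` carrier_vec n\<rparr>)
      + subspace_dim n {v \<in> carrier_vec n. M *\<^sub>v v = \<zero>\<^bsub>R.V\<^esub>} = subspace_dim n (carrier_vec n :: 'k vec set)"
    using M R.vectorspace_axioms
    by (intro rank_nullity_lin_subspace[OF full])
      (auto simp: mult_add_distrib_mat_vec[OF M] mult_mat_vec[OF M] module_vec_simps)
  moreover have "(\<lambda>v. M *\<^sub>v v) ` carrier_vec n = R.span (set (cols M))"
    using R.col_space_eq[OF M] M unfolding R.col_space_def by (auto simp: image_iff)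
  moreover have "subspace_dim n (carrier_vec n :: 'k vec set) = n"
    using N.dim_is_n by (simp add: module_vec_def)
  moreover have "{v \<in> carrier_vec n. M *\<^sub>v v = \<zero>\<^bsub>R.V\<^esub>} = mat_kernel M"
    unfolding mat_kernel[OF M] by (simp add: module_vec_simps)
  ultimately show "vec_space.rank r M + subspace_dim n (mat_kernel M) = n"
    unfolding R.rank_def by simp
qed

definition indicator_vec :: "nat \<Rightarrow> nat set \<Rightarrow> 'k::field vec" where
  "indicator_vec n S = vec n (\<lambda>i. if i \<in> S then 1 else 0)"

lemma indicator_vec_carrier [simp]: "indicator_vec n S \<in> carrier_vec n"
  by (simp add: indicator_vec_def)

lemma supp_indicator_vec: "S \<subseteq> {..<n} \<Longrightarrow> supp (indicator_vec n S :: 'k::field vec) = S"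
  by (auto simp: supp_def indicator_vec_def split: if_splits)

lemma support_vec_eq: "v \<in> carrier_vec n \<Longrightarrow> support_vec v = indicator_vec n (supp v)"
  by (auto simp: support_vec_def indicator_vec_def supp_def vec_eq_iff)

lemma support_less_iff: "support_less s t \<longleftrightarrow> supp s \<subset> supp t"
  by (simp add: support_less_def supp_def)

lemma scalar_prod_indicator_vec:
  fixes v :: "'k::field vec"
  assumes "v \<in> carrier_vec n" "S \<subseteq> {..<n}"
  shows "indicator_vec n S \<bullet> v = coord_sum S v"
proof -
  have "indicator_vec n S \<bullet> v = (\<Sum>i\<in>{0..<n}. (if i \<in> S then v $ i else 0))"
    unfolding scalar_prod_def using assms(1)
    by (intro sum.cong) (auto simp: indicator_vec_def)
  also have "\<dots> = (\<Sum>i\<in>{0..<n} \<inter> S. v $ i)"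
    by (simp add: sum.inter_restrict)
  also have "{0..<n} \<inter> S = S" using assms(2) by auto
  finally show ?thesis by (simp add: coord_sum_def)
qed

lemma mult_mat_unit_vec:
  "A \<in> carrier_mat r n \<Longrightarrow> i < n \<Longrightarrow> A *\<^sub>v unit_vec n i = col (A :: 'k::field mat) i"
  by (auto simp: vec_eq_iff)

lemma mat_kernel_append_rows:
  fixes A :: "'k::field mat"
  assumes A: "A \<in> carrier_mat r n" and ss: "set ss \<subseteq> carrier_vec n"
  shows "mat_kernel (A @\<^sub>r mat_of_rows n ss) = {v \<in> mat_kernel A. \<forall>s\<in>set ss. s \<bullet> v = 0}"
proof -
  let ?B = "mat_of_rows n ss"
  have B: "?B \<in> carrier_mat (length ss) n" by simp
  have AB: "A @\<^sub>r ?B \<in> carrier_mat (r + length ss) n" using A B by (rule carrier_append_rows)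
  have "(A @\<^sub>r ?B) *\<^sub>v v = 0\<^sub>v (r + length ss) \<longleftrightarrow> A *\<^sub>v v = 0\<^sub>v r \<and> (\<forall>s\<in>set ss. s \<bullet> v = 0)"
    if v: "v \<in> carrier_vec n" for v
  proof -
    have "(A @\<^sub>r ?B) *\<^sub>v v = (A *\<^sub>v v) @\<^sub>v (?B *\<^sub>v v)"
      by (rule mat_mult_append[OF A B v])
    moreover have "(0\<^sub>v (r + length ss) :: 'k vec) = 0\<^sub>v r @\<^sub>v 0\<^sub>v (length ss)"
      by (auto simp: append_vec_def vec_eq_iff)
    moreover have "?B *\<^sub>v v = 0\<^sub>v (length ss) \<longleftrightarrow> (\<forall>i<length ss. (ss ! i) \<bullet> v = 0)"
      using ss by (auto simp: vec_eq_iff mult_mat_vec_def subset_iff)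
    ultimately show ?thesis
      using A v append_vec_eq[of "A *\<^sub>v v" r "0\<^sub>v r" "?B *\<^sub>v v" "0\<^sub>v (length ss)"]
      by (auto simp: all_set_conv_all_nth)
  qed
  then show ?thesis
    unfolding mat_kernel[OF AB] mat_kernel[OF A] by auto
qed

locale configuration = relation_space n "mat_kernel A"
  for n :: nat and A :: "'k::field_char_0 mat" +
  fixes r :: nat
  assumes A_carrier: "A \<in> carrier_mat r n"
begin

lemma ker_supports_eq: "ker_supports A = indicator_vec n ` {S. cyclic S \<and> S \<noteq> {}}"
proof -
  have zero: "v \<noteq> 0\<^sub>v n \<longleftrightarrow> supp v \<noteq> {}" if "v \<in> mat_kernel A" for v
    using carrier_vecD[OF K_carrier[OF that]] by (auto simp: supp_def vec_eq_iff)
  have "ker_supports A = support_vec ` {v \<in> mat_kernel A. v \<noteq> 0\<^sub>v n}"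
    unfolding ker_supports_def carrier_matD(2)[OF A_carrier] by blast
  also have "\<dots> = (indicator_vec n \<circ> supp) ` {v \<in> mat_kernel A. supp v \<noteq> {}}"
    using zero support_vec_eq[OF K_carrier] by (intro image_cong) auto
  also have "\<dots> = indicator_vec n ` {S. cyclic S \<and> S \<noteq> {}}"
    unfolding image_comp[symmetric] cyclic_def by (rule arg_cong[of _ _ "image _"]) blast
  finally show ?thesis .
qed

lemma indicator_vec_inj:
  "cyclic S \<Longrightarrow> cyclic T \<Longrightarrow> indicator_vec n S = (indicator_vec n T :: 'k vec) \<Longrightarrow> S = T"
  using supp_indicator_vec cyclic_subset by metis

lemma support_less_indicator_vec:
  "cyclic S \<Longrightarrow> cyclic T \<Longrightarrow>
    support_less (indicator_vec n S) (indicator_vec n T :: 'k vec) \<longleftrightarrow> S \<subset> T"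
  by (simp add: support_less_iff supp_indicator_vec cyclic_subset)

lemma rank_chain_matrix:
  assumes C: "\<And>S. S \<in> C \<Longrightarrow> cyclic S" and ss: "set ss = indicator_vec n ` C"
  shows "vec_space.rank (dim_row (chain_matrix A ss)) (chain_matrix A ss)
    + subspace_dim n (balanced C {..<n}) = n"
proof -
  have M: "chain_matrix A ss \<in> carrier_mat (r + length ss) n"
    unfolding chain_matrix_def using A_carrier by auto
  have "mat_kernel (chain_matrix A ss) = {v \<in> mat_kernel A. \<forall>s\<in>set ss. s \<bullet> v = 0}"
    unfolding chain_matrix_def carrier_matD(2)[OF A_carrier]
    by (rule mat_kernel_append_rows[OF A_carrier]) (auto simp: ss)
  also have "\<dots> = balanced C {..<n}"
    using supp_subset[OF K_carrier] scalar_prod_indicator_vec[OF K_carrier cyclic_subset] C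
    by (auto simp: ss balanced_def rel_def)
  finally show ?thesis
    using rank_plus_kernel_dim(2)[OF M] M by simp
qed

text \<open>
  A flag is saturated: nothing comparable with all its members can be inserted.
\<close>

lemma flag_refines:
  assumes "flag Ts" "cyclic R" "R \<noteq> {}" "R \<subseteq> flag_top Ts" "\<And>S. S \<in> set Ts \<Longrightarrow> S \<subseteq> R \<or> R \<subseteq> S"
  shows "R \<in> set Ts"
  using assms
proof (induction Ts)
  case (flag_Cons Ts T)
  show ?case
  proof (cases "R \<subseteq> flag_top Ts")
    case True
    then show ?thesis using flag_Cons by simp
  next
    case False
    then have "flag_top Ts \<subset> R" using flag_Cons.prems(4)[of "flag_top Ts"] by (cases Ts) auto
    then have "R = T" using flag_Cons.hyps(2) flag_Cons.prems(1,3) by (auto simp: covers_def)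
    then show ?thesis by simp
  qed
qed simp

lemma flag_sorted: "flag Ts \<Longrightarrow> sorted_wrt (\<lambda>S T. T \<subset> S) Ts"
proof (induction Ts rule: flag.induct)
  case (flag_Cons Ts T)
  then show ?case using flag_members[OF flag_Cons(1)] by (fastforce simp: covers_def)
qed simp

lemma flag_maximal_support_chain:
  assumes fl: "flag Ts" and flag_top: "flag_top Ts = {..<n}"
  shows "maximal_support_chain A (rev (map (indicator_vec n) Ts))"
proof -
  note mem = flag_members[OF fl]
  have "sorted_wrt support_less (rev (map (indicator_vec n) Ts :: 'k vec list))"
    unfolding sorted_wrt_rev sorted_wrt_map
  proof (rule sorted_wrt_mono_rel[OF _ flag_sorted[OF fl]])
    show "support_less (indicator_vec n T) (indicator_vec n S :: 'k vec)"
      if "S \<in> set Ts" "T \<in> set Ts" "T \<subset> S" for S T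
      using mem[OF that(1)] mem[OF that(2)] that(3) by (simp add: support_less_indicator_vec)
  qed
  moreover have "pred_on.maxchain (ker_supports A) support_less (indicator_vec n ` set Ts)"
    unfolding pred_on.maxchain_def
  proof (intro conjI notI)
    have tri: "S \<subset> T \<or> S = T \<or> T \<subset> S" if ST: "S \<in> set Ts" "T \<in> set Ts" for S T
    proof -
      obtain i j where ij: "i < length Ts" "j < length Ts" "S = Ts ! i" "T = Ts ! j"
        using ST unfolding in_set_conv_nth by blast
      then show ?thesis
        using sorted_wrt_nth_less[OF flag_sorted[OF fl], of i j]
          sorted_wrt_nth_less[OF flag_sorted[OF fl], of j i]
        by (cases i j rule: linorder_cases) simp_all
    qed
    have "support_less\<^sup>=\<^sup>= (indicator_vec n S) (indicator_vec n T :: 'k vec) \<or>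
        support_less\<^sup>=\<^sup>= (indicator_vec n T) (indicator_vec n S :: 'k vec)"
      if "S \<in> set Ts" "T \<in> set Ts" for S T
      using support_less_indicator_vec[of S T] support_less_indicator_vec[of T S]
        mem[OF that(1)] mem[OF that(2)] tri[OF that] by auto
    moreover have "indicator_vec n ` set Ts \<subseteq> ker_supports A"
      unfolding ker_supports_eq using mem by blast
    ultimately show "pred_on.chain (ker_supports A) support_less (indicator_vec n ` set Ts)"
      unfolding pred_on.chain_def by blast
  next
    assume "\<exists>S. pred_on.chain (ker_supports A) support_less S \<and> indicator_vec n ` set Ts \<subset> S"
    then obtain X where X: "pred_on.chain (ker_supports A) support_less X"
      "indicator_vec n ` set Ts \<subset> X" by blast
    then obtain x where x: "x \<in> X" "x \<notin> indicator_vec n ` set Ts" by blast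
    then obtain R where R: "cyclic R" "R \<noteq> {}" "x = indicator_vec n R"
      using X(1) unfolding pred_on.chain_def ker_supports_eq by blast
    have "S \<subseteq> R \<or> R \<subseteq> S" if S: "S \<in> set Ts" for S
    proof -
      have "indicator_vec n S \<in> X" using S X(2) by blast
      then have "support_less\<^sup>=\<^sup>= (indicator_vec n S) x \<or> support_less\<^sup>=\<^sup>= x (indicator_vec n S)"
        using X(1) x(1) unfolding pred_on.chain_def by blast
      then have "support_less (indicator_vec n S) x \<or> indicator_vec n S = x \<or>
          support_less x (indicator_vec n S)"
        by blast
      moreover have "cyclic S" using mem[OF S] by blast
      ultimately have "S \<subset> R \<or> S = R \<or> R \<subset> S"
        unfolding R(3) using support_less_indicator_vec indicator_vec_inj R(1) by metis
      then show ?thesis by blast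
    qed
    then have "R \<in> set Ts"
      using flag_refines[OF fl R(1,2)] flag_top cyclic_subset[OF R(1)] by blast
    then show False using x(2) R(3) by blast
  qed
  ultimately show ?thesis by (simp add: maximal_support_chain_def)
qed

lemma maximal_support_chain_cyclic:
  assumes "maximal_support_chain A ss"
  shows "\<exists>C. finite C \<and> set ss = indicator_vec n ` C \<and> (\<forall>S\<in>C. cyclic S) \<and>
    (\<forall>S\<in>C. \<forall>T\<in>C. S \<subseteq> T \<or> T \<subseteq> S)"
proof -
  have ch: "pred_on.chain (ker_supports A) support_less (set ss)"
    using assms by (simp add: maximal_support_chain_def pred_on.maxchain_def)
  define C where "C = supp ` set ss"
  have *: "cyclic (supp s) \<and> indicator_vec n (supp s) = s" if "s \<in> set ss" for s
    using ch that unfolding pred_on.chain_def ker_supports_eq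
    by (auto simp: supp_indicator_vec[OF cyclic_subset])
  then have "set ss = indicator_vec n ` C" unfolding C_def by (auto simp: image_iff)
  moreover have "supp s \<subseteq> supp t \<or> supp t \<subseteq> supp s" if "s \<in> set ss" "t \<in> set ss" for s t
    using ch that unfolding pred_on.chain_def support_less_iff by blast
  ultimately show ?thesis using * unfolding C_def by (intro exI[of _ "supp ` set ss"]) (auto simp: C_def)
qed

lemma flag_rank_ge:
  assumes "flag Ts" "flag_top Ts = {..<n}"
  shows "\<exists>ss. maximal_support_chain A ss \<and>
    n \<le> vec_space.rank (dim_row (chain_matrix A ss)) (chain_matrix A ss) + affine_steps Ts"
proof -
  let ?ss = "rev (map (indicator_vec n) Ts) :: 'k vec list"
  have "vec_space.rank (dim_row (chain_matrix A ?ss)) (chain_matrix A ?ss)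
      + subspace_dim n (balanced (set Ts) {..<n}) = n"
    using flag_members[OF assms(1)] by (intro rank_chain_matrix) auto
  then show ?thesis
    using dim_balanced_le_affine_steps[OF assms(1)] flag_maximal_support_chain[OF assms] assms(2)
    by (intro exI[of _ ?ss]) simp
qed

lemma rank_le_flag:
  assumes "maximal_support_chain A ss"
  shows "\<exists>Ts. flag Ts \<and> flag_top Ts = {..<n} \<and>
    vec_space.rank (dim_row (chain_matrix A ss)) (chain_matrix A ss) + affine_steps Ts \<le> n"
proof -
  obtain C where C: "finite C" "set ss = indicator_vec n ` C" "\<forall>S\<in>C. cyclic S"
    "\<forall>S\<in>C. \<forall>T\<in>C. S \<subseteq> T \<or> T \<subseteq> S"
    using maximal_support_chain_cyclic[OF assms] by blast
  have "vec_space.rank (dim_row (chain_matrix A ss)) (chain_matrix A ss)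
    + subspace_dim n (balanced C {..<n}) = n"
    using C by (intro rank_chain_matrix) auto
  moreover obtain Ts where "flag Ts" "flag_top Ts = {..<n}"
      "affine_steps Ts \<le> subspace_dim n (balanced C {..<n})"
    using flag_affine_steps_le_dim_balanced[OF cyclic_UNIV C(1)] C(3,4) cyclic_subset by blast
  ultimately show ?thesis by (intro exI[of _ Ts]) simp
qed

lemma rho_eq:
  assumes fl: "flag Ts" "flag_top Ts = {..<n}"
    and least: "\<And>Ts'. flag Ts' \<Longrightarrow> flag_top Ts' = {..<n} \<Longrightarrow> affine_steps Ts \<le> affine_steps Ts'"
  shows "rho A + affine_steps Ts = n"
proof -
  let ?r = "\<lambda>ss. vec_space.rank (dim_row (chain_matrix A ss)) (chain_matrix A ss)"
  have le: "?r ss + affine_steps Ts \<le> n" if "maximal_support_chain A ss" for ss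
    using rank_le_flag[OF that] least by (meson add_le_cancel_left order_trans)
  obtain ss where ss: "maximal_support_chain A ss" "n \<le> ?r ss + affine_steps Ts"
    using flag_rank_ge[OF fl] by blast
  have "rho A = ?r ss"
    unfolding rho_def
  proof (rule Max_eqI)
    have "{?r ss | ss. maximal_support_chain A ss} \<subseteq> {..n}" using le by fastforce
    then show "finite {?r ss | ss. maximal_support_chain A ss}" using finite_subset by blast
    show "y \<le> ?r ss" if "y \<in> {?r ss | ss. maximal_support_chain A ss}" for y
      using that le ss by fastforce
  qed (use ss in blast)
  then show ?thesis using le[OF ss(1)] ss(2) by simp
qed

end

section \<open>Linear combinations, affine dimension and quotients\<close>

context
  fixes V :: "('k::field, 'v) module"
  assumes V: "vectorspace class_ring V"
begin

interpretation V: vectorspace class_ring V by (rule V)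

lemma comb_closed: "x ` J \<subseteq> carrier V \<Longrightarrow> comb V x J c \<in> carrier V"
  unfolding comb_def by (rule V.finsum_closed) auto

lemma comb_empty: "comb V x {} c = \<zero>\<^bsub>V\<^esub>"
  unfolding comb_def by simp

lemma comb_insert:
  assumes "finite J" "j \<notin> J" "x ` insert j J \<subseteq> carrier V"
  shows "comb V x (insert j J) c = (c j \<odot>\<^bsub>V\<^esub> x j) \<oplus>\<^bsub>V\<^esub> comb V x J c"
  unfolding comb_def using assms by (intro V.finsum_insert) auto

lemma comb_cong:
  assumes "x ` J \<subseteq> carrier V" "\<And>i. i \<in> J \<Longrightarrow> c i = d i"
  shows "comb V x J c = comb V x J d"
  unfolding comb_def using assms by (intro V.finsum_cong') auto

lemma comb_add:
  assumes "x ` J \<subseteq> carrier V"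
  shows "comb V x J (\<lambda>i. c i + d i) = comb V x J c \<oplus>\<^bsub>V\<^esub> comb V x J d"
proof -
  have "comb V x J (\<lambda>i. c i + d i) = (\<Oplus>\<^bsub>V\<^esub>i\<in>J. (c i \<odot>\<^bsub>V\<^esub> x i) \<oplus>\<^bsub>V\<^esub> (d i \<odot>\<^bsub>V\<^esub> x i))"
    unfolding comb_def
  proof (rule V.finsum_cong')
    show "(c i + d i) \<odot>\<^bsub>V\<^esub> x i = (c i \<odot>\<^bsub>V\<^esub> x i) \<oplus>\<^bsub>V\<^esub> (d i \<odot>\<^bsub>V\<^esub> x i)" if "i \<in> J" for i
      using V.smult_l_distr[of "c i" "d i" "x i"] that assms by auto
  qed (use assms in auto)
  also have "\<dots> = comb V x J c \<oplus>\<^bsub>V\<^esub> comb V x J d"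
    unfolding comb_def using assms by (intro V.finsum_addf) auto
  finally show ?thesis .
qed

lemma comb_smult:
  assumes "x ` J \<subseteq> carrier V" "finite J"
  shows "comb V x J (\<lambda>i. a * c i) = a \<odot>\<^bsub>V\<^esub> comb V x J c"
proof -
  have "comb V x J (\<lambda>i. a * c i) = (\<Oplus>\<^bsub>V\<^esub>i\<in>J. a \<odot>\<^bsub>V\<^esub> (c i \<odot>\<^bsub>V\<^esub> x i))"
    unfolding comb_def
  proof (rule V.finsum_cong')
    show "(a * c i) \<odot>\<^bsub>V\<^esub> x i = a \<odot>\<^bsub>V\<^esub> (c i \<odot>\<^bsub>V\<^esub> x i)" if "i \<in> J" for i
      using V.smult_assoc1[of a "c i" "x i"] that assms by auto
  qed (use assms in auto)
  also have "\<dots> = a \<odot>\<^bsub>V\<^esub> comb V x J c"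
    unfolding comb_def using assms by (intro V.finsum_smult_ldistr[symmetric]) auto
  finally show ?thesis .
qed

lemma comb_diff:
  assumes "x ` J \<subseteq> carrier V" "finite J"
  shows "comb V x J (\<lambda>i. c i - d i) = comb V x J c \<ominus>\<^bsub>V\<^esub> comb V x J d"
proof -
  have "comb V x J (\<lambda>i. c i - d i) = comb V x J (\<lambda>i. c i + (- 1) * d i)"
    by simp
  also have "\<dots> = comb V x J c \<oplus>\<^bsub>V\<^esub> ((- 1) \<odot>\<^bsub>V\<^esub> comb V x J d)"
    using comb_add[OF assms(1), of c "\<lambda>i. (- 1) * d i"] comb_smult[OF assms, of "- 1" d] by simp
  also have "(- 1) \<odot>\<^bsub>V\<^esub> comb V x J d = \<ominus>\<^bsub>V\<^esub> comb V x J d"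
    using V.smult_minus_1[OF comb_closed[OF assms(1)], of d]
    by (simp add: class_ring_simps)
  finally show ?thesis by (simp add: a_minus_def)
qed

lemma comb_hom:
  fixes W :: "('k, 'w) module"
  assumes W: "vectorspace class_ring W"
    and car: "\<And>v. v \<in> carrier V \<Longrightarrow> f v \<in> carrier W"
    and add: "\<And>v w. v \<in> carrier V \<Longrightarrow> w \<in> carrier V \<Longrightarrow> f (v \<oplus>\<^bsub>V\<^esub> w) = f v \<oplus>\<^bsub>W\<^esub> f w"
    and smult: "\<And>a v. v \<in> carrier V \<Longrightarrow> f (a \<odot>\<^bsub>V\<^esub> v) = a \<odot>\<^bsub>W\<^esub> f v"
    and x: "x ` J \<subseteq> carrier V" and J: "finite J"
  shows "f (comb V x J c) = comb W (\<lambda>i. f (x i)) J c"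
proof -
  interpret W: vectorspace class_ring W by (rule W)
  have zero: "f \<zero>\<^bsub>V\<^esub> = \<zero>\<^bsub>W\<^esub>"
    using smult[of "\<zero>\<^bsub>V\<^esub>" 0] V.lmult_0[of "\<zero>\<^bsub>V\<^esub>"] W.lmult_0[of "f \<zero>\<^bsub>V\<^esub>"] car[of "\<zero>\<^bsub>V\<^esub>"]
    by simp
  show ?thesis using J x
  proof (induction J rule: finite_induct)
    case empty
    show ?case unfolding comb_def by (simp add: zero)
  next
    case (insert j J)
    have xJ: "x ` J \<subseteq> carrier V" and xj: "x j \<in> carrier V" using insert.prems by auto
    have "f (comb V x (insert j J) c) = (c j \<odot>\<^bsub>W\<^esub> f (x j)) \<oplus>\<^bsub>W\<^esub> f (comb V x J c)"
      using comb_insert[OF insert.hyps insert.prems] add[OF _ comb_closed[OF xJ], of "c j \<odot>\<^bsub>V\<^esub> x j" c]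
        smult[OF xj] xj by simp
    also have "f (comb V x J c) = comb W (\<lambda>i. f (x i)) J c" using insert.IH xJ by simp
    also have "(c j \<odot>\<^bsub>W\<^esub> f (x j)) \<oplus>\<^bsub>W\<^esub> \<dots> = comb W (\<lambda>i. f (x i)) (insert j J) c"
      unfolding comb_def using insert.hyps car xJ xj by (intro W.finsum_insert[symmetric]) auto
    finally show ?case .
  qed
qed

text \<open>
  The space of directions of an affine span is the image of the coefficient vectors with sum zero,
  so rank-nullity reads the affine dimension off the space of affine relations.
\<close>

lemma aff_dim_eq:
  assumes J: "J \<subseteq> {..<n}" "J \<noteq> {}" and x: "x ` J \<subseteq> carrier V"
  shows "aff_dim V x J = int (card J) - 1 -
    int (subspace_dim n {c \<in> carrier_vec n. supp c \<subseteq> J \<and> coord_sum J c = 0 \<and>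
      comb V x J (\<lambda>i. c $ i) = \<zero>\<^bsub>V\<^esub>})"
proof -
  let ?S = "{c \<in> carrier_vec n :: 'k vec set. supp c \<subseteq> J}"
  let ?Z = "{c \<in> ?S. coord_sum J c = 0}"
  let ?f = "\<lambda>c. comb V x J (\<lambda>i. c $ i)"
  have fin: "finite J" using J(1) finite_subset by blast
  obtain j where j: "j \<in> J" using J(2) by blast
  note S = subspace_dim_support[OF J(1), where ?'k = 'k]
  have Z: "lin_subspace n ?Z" by (rule lin_subspace_coord_sum[OF S(1) J(1)])
  have unit: "unit_vec n j \<in> ?S" "coord_sum J (unit_vec n j :: 'k vec) = 1"
    using j J(1) fin by (auto simp: supp_def coord_sum_def unit_vec_def subset_iff sum.If_cases
        split: if_splits)
  have add: "?f (c + d) = ?f c \<oplus>\<^bsub>V\<^esub> ?f d" if "c \<in> carrier_vec n" "d \<in> carrier_vec n" for c d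
    unfolding comb_add[OF x, symmetric] using that J(1) by (intro comb_cong[OF x]) auto
  have smult: "?f (a \<cdot>\<^sub>v c) = a \<odot>\<^bsub>V\<^esub> ?f c" if "c \<in> carrier_vec n" for a c
    unfolding comb_smult[OF x fin, symmetric] using that J(1) by (intro comb_cong[OF x]) auto
  have "card J = subspace_dim n ?Z + 1"
  proof -
    have "subspace_dim n ?S = subspace_dim n ?Z + (if \<exists>c\<in>?S. coord_sum J c \<noteq> 0 then 1 else 0)"
    proof (rule subspace_dim_functional[OF S(1)])
      show "coord_sum J (v + w) = coord_sum J v + coord_sum J w" if "v \<in> ?S" "w \<in> ?S" for v w
        using that J(1) by (intro coord_sum_add) auto
      show "coord_sum J (a \<cdot>\<^sub>v v) = a * coord_sum J v" if "v \<in> ?S" for a v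
        using that J(1) by (intro coord_sum_smult) auto
    qed
    moreover have "\<exists>c\<in>?S. coord_sum J c \<noteq> 0"
      using unit by (intro bexI[of _ "unit_vec n j"]) auto
    ultimately show ?thesis unfolding S(2) by simp
  qed
  moreover have "vectorspace.dim class_ring (V\<lparr>carrier := ?f ` ?Z\<rparr>)
      + subspace_dim n {c \<in> ?Z. ?f c = \<zero>\<^bsub>V\<^esub>} = subspace_dim n ?Z"
  proof (rule rank_nullity_lin_subspace[OF Z V])
    show "?f c \<in> carrier V" for c :: "'k vec" by (rule comb_closed[OF x])
    show "?f (c + d) = ?f c \<oplus>\<^bsub>V\<^esub> ?f d" if "c \<in> ?Z" "d \<in> ?Z" for c d
      using that by (intro add) auto
    show "?f (a \<cdot>\<^sub>v c) = a \<odot>\<^bsub>V\<^esub> ?f c" if "c \<in> ?Z" for a c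
      using that by (intro smult) auto
  qed
  moreover have "{p \<ominus>\<^bsub>V\<^esub> q | p q. p \<in> aff_span V x J \<and> q \<in> aff_span V x J} = ?f ` ?Z" (is "?D = _")
  proof (intro equalityI subsetI)
    fix y assume "y \<in> ?D"
    then obtain c d where cd: "(\<Sum>i\<in>J. c i) = 1" "(\<Sum>i\<in>J. d i) = 1"
      and y: "y = comb V x J c \<ominus>\<^bsub>V\<^esub> comb V x J d"
      unfolding aff_span_def by blast
    let ?z = "vec n (\<lambda>i. if i \<in> J then c i - d i else 0)"
    have "supp ?z \<subseteq> J" by (auto simp: supp_def split: if_splits)
    moreover have "coord_sum J ?z = (\<Sum>i\<in>J. c i - d i)"
      unfolding coord_sum_def using J(1) by (intro sum.cong) auto
    then have "coord_sum J ?z = 0" using cd by (simp add: sum_subtractf)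
    moreover have "?f ?z = comb V x J (\<lambda>i. c i - d i)"
      using J(1) by (intro comb_cong[OF x]) auto
    then have "y = ?f ?z" using comb_diff[OF x fin] y by simp
    ultimately show "y \<in> ?f ` ?Z" by (intro image_eqI[of _ _ ?z]) auto
  next
    fix y assume "y \<in> ?f ` ?Z"
    then obtain z where z: "z \<in> ?Z" "y = ?f z" by blast
    let ?u = "\<lambda>i. if i = j then 1 else (0::'k)"
    have u: "(\<Sum>i\<in>J. ?u i) = 1" using fin j by simp
    then have zu: "(\<Sum>i\<in>J. z $ i + ?u i) = 1"
      using z(1) by (simp add: sum.distrib coord_sum_def)
    have "y = comb V x J (\<lambda>i. (z $ i + ?u i) - ?u i)"
      unfolding z(2) by (intro comb_cong[OF x]) simp
    also have "\<dots> = comb V x J (\<lambda>i. z $ i + ?u i) \<ominus>\<^bsub>V\<^esub> comb V x J ?u"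
      by (rule comb_diff[OF x fin])
    finally show "y \<in> ?D" unfolding aff_span_def using u zu by blast
  qed
  moreover have "{c \<in> ?Z. ?f c = \<zero>\<^bsub>V\<^esub>} = {c \<in> carrier_vec n. supp c \<subseteq> J \<and> coord_sum J c = 0 \<and>
      ?f c = \<zero>\<^bsub>V\<^esub>}" by auto
  ultimately show ?thesis
    unfolding aff_dim_def using J(2) by simp
qed

context
  fixes L
  assumes L: "submodule class_ring L V"
begin

lemma abelian_subgroup_submodule: "abelian_subgroup L V"
proof -
  have neg: "\<ominus>\<^bsub>V\<^esub> v \<in> L" if "v \<in> L" for v
  proof -
    have "v \<in> carrier V" using that submodule.subset[OF L] by blast
    then have "\<ominus>\<^bsub>V\<^esub> v = (\<ominus>\<^bsub>class_ring\<^esub> 1) \<odot>\<^bsub>V\<^esub> v"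
      using V.smult_minus_1[of v] by simp
    then show ?thesis using submodule.smult_closed[OF L _ that] by simp
  qed
  have "subgroup L (add_monoid V)"
    by (rule V.add.subgroupI)
      (use submodule.subset[OF L] submodule.zero_closed[OF L] submodule.m_closed[OF L] neg in auto)
  then show ?thesis
    by (intro abelian_subgroupI3 additive_subgroupI V.abelian_group_axioms)
qed

interpretation L: abelian_subgroup L V by (rule abelian_subgroup_submodule)

lemma quot_carrier: "carrier (quot_space V L) = quot_proj V L ` carrier V"
  unfolding quot_space_def quot_proj_def A_RCOSETS_def' by auto

lemma quot_zero: "\<zero>\<^bsub>quot_space V L\<^esub> = L"
  by (simp add: quot_space_def)

lemma quot_add:
  "v \<in> carrier V \<Longrightarrow> w \<in> carrier V \<Longrightarrow>
    quot_proj V L v \<oplus>\<^bsub>quot_space V L\<^esub> quot_proj V L w = quot_proj V L (v \<oplus>\<^bsub>V\<^esub> w)"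
  unfolding quot_space_def quot_proj_def by (simp add: L.a_rcos_sum)

lemma quot_proj_zero_iff:
  assumes "v \<in> carrier V"
  shows "quot_proj V L v = L \<longleftrightarrow> v \<in> L"
  unfolding quot_proj_def
  using V.a_coset_join1[OF _ assms L.a_subgroup] V.a_coset_join2[OF assms L.a_subgroup] by blast

lemma quot_smult:
  assumes v: "v \<in> carrier V"
  shows "a \<odot>\<^bsub>quot_space V L\<^esub> quot_proj V L v = quot_proj V L (a \<odot>\<^bsub>V\<^esub> v)"
proof -
  have av: "a \<odot>\<^bsub>V\<^esub> v \<in> carrier V" using v by simp
  have "L +>\<^bsub>V\<^esub> (a \<odot>\<^bsub>V\<^esub> w) = L +>\<^bsub>V\<^esub> (a \<odot>\<^bsub>V\<^esub> v)" if w: "w \<in> L +>\<^bsub>V\<^esub> v" for w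
  proof -
    obtain l where l: "l \<in> L" "w = l \<oplus>\<^bsub>V\<^esub> v" using w unfolding a_r_coset_def' by blast
    then have lV: "l \<in> carrier V" using L.a_subset by blast
    have "a \<odot>\<^bsub>V\<^esub> w = (a \<odot>\<^bsub>V\<^esub> l) \<oplus>\<^bsub>V\<^esub> (a \<odot>\<^bsub>V\<^esub> v)"
      using V.smult_r_distr[of a l v] l lV v by simp
    moreover have "a \<odot>\<^bsub>V\<^esub> l \<in> L" using submodule.smult_closed[OF L _ l(1)] by simp
    ultimately have "a \<odot>\<^bsub>V\<^esub> w \<in> L +>\<^bsub>V\<^esub> (a \<odot>\<^bsub>V\<^esub> v)"
      using V.a_rcosI[OF _ L.a_subset av] by simp
    then show ?thesis using L.a_repr_independence'[OF _ av] by simp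
  qed
  moreover have "v \<in> L +>\<^bsub>V\<^esub> v" using v by (rule L.a_rcos_self)
  ultimately have "(\<Union>w\<in>L +>\<^bsub>V\<^esub> v. L +>\<^bsub>V\<^esub> (a \<odot>\<^bsub>V\<^esub> w)) = L +>\<^bsub>V\<^esub> (a \<odot>\<^bsub>V\<^esub> v)"
    by blast
  then show ?thesis
    by (simp add: quot_space_def quot_proj_def)
qed

text \<open>
  All axioms transfer along the projection, which is surjective and compatible with the operations.
\<close>

lemma quot_vectorspace: "vectorspace class_ring (quot_space V L)"
proof (rule vs_criteria)
  have LV: "L = quot_proj V L \<zero>\<^bsub>V\<^esub>"
    using quot_proj_zero_iff[of "\<zero>\<^bsub>V\<^esub>"] submodule.zero_closed[OF L] by simp
  show "field (class_ring :: 'k ring)" by (rule class_field)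
  show "\<zero>\<^bsub>quot_space V L\<^esub> \<in> carrier (quot_space V L)"
    unfolding quot_carrier quot_zero by (subst LV) simp
  show "\<forall>v\<in>carrier (quot_space V L). \<exists>w\<in>carrier (quot_space V L).
      v \<oplus>\<^bsub>quot_space V L\<^esub> w = \<zero>\<^bsub>quot_space V L\<^esub>"
    unfolding quot_carrier quot_zero
  proof (intro ballI, elim imageE)
    fix X v assume v: "X = quot_proj V L v" "v \<in> carrier V"
    have "X \<oplus>\<^bsub>quot_space V L\<^esub> quot_proj V L (\<ominus>\<^bsub>V\<^esub> v) = L"
      unfolding v(1) using quot_add[OF v(2), of "\<ominus>\<^bsub>V\<^esub> v"] V.r_neg[OF v(2)] LV v(2) by simp
    then show "\<exists>w\<in>quot_proj V L ` carrier V. X \<oplus>\<^bsub>quot_space V L\<^esub> w = L"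
      using v(2) by blast
  qed
  show "\<forall>v\<in>carrier (quot_space V L). v \<oplus>\<^bsub>quot_space V L\<^esub> \<zero>\<^bsub>quot_space V L\<^esub> = v"
    unfolding quot_carrier quot_zero
  proof (intro ballI, elim imageE)
    fix X v assume v: "X = quot_proj V L v" "v \<in> carrier V"
    have "X \<oplus>\<^bsub>quot_space V L\<^esub> quot_proj V L \<zero>\<^bsub>V\<^esub> = X"
      unfolding v(1) using quot_add[OF v(2), of "\<zero>\<^bsub>V\<^esub>"] v(2) by simp
    then show "X \<oplus>\<^bsub>quot_space V L\<^esub> L = X" using LV by simp
  qed
next
  have dl: "(a + b) \<odot>\<^bsub>V\<^esub> v = (a \<odot>\<^bsub>V\<^esub> v) \<oplus>\<^bsub>V\<^esub> (b \<odot>\<^bsub>V\<^esub> v)" if "v \<in> carrier V" for a b v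
    using V.smult_l_distr[of a b v] that by simp
  have dr: "a \<odot>\<^bsub>V\<^esub> (v \<oplus>\<^bsub>V\<^esub> w) = (a \<odot>\<^bsub>V\<^esub> v) \<oplus>\<^bsub>V\<^esub> (a \<odot>\<^bsub>V\<^esub> w)"
    if "v \<in> carrier V" "w \<in> carrier V" for a v w
    using V.smult_r_distr[of a v w] that by simp
  have sa: "(a * b) \<odot>\<^bsub>V\<^esub> v = a \<odot>\<^bsub>V\<^esub> (b \<odot>\<^bsub>V\<^esub> v)" if "v \<in> carrier V" for a b v
    using V.smult_assoc1[of a b v] that by simp
  have one: "1 \<odot>\<^bsub>V\<^esub> v = v" if "v \<in> carrier V" for v
    using V.smult_one[OF that] by simp
  have sc: "a \<odot>\<^bsub>V\<^esub> v \<in> carrier V" if "v \<in> carrier V" for a v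
    using that by simp
  let ?Q = "quot_space V L"
  show "\<forall>v w. v \<in> carrier ?Q \<and> w \<in> carrier ?Q \<longrightarrow> v \<oplus>\<^bsub>?Q\<^esub> w \<in> carrier ?Q"
    unfolding quot_carrier by (clarsimp simp: quot_add)
  show "\<forall>c v. c \<in> carrier class_ring \<and> v \<in> carrier ?Q \<longrightarrow> c \<odot>\<^bsub>?Q\<^esub> v \<in> carrier ?Q"
    unfolding quot_carrier by (clarsimp simp: quot_smult sc)
  show "\<forall>v w. v \<in> carrier ?Q \<and> w \<in> carrier ?Q \<longrightarrow> v \<oplus>\<^bsub>?Q\<^esub> w = w \<oplus>\<^bsub>?Q\<^esub> v"
    unfolding quot_carrier by (clarsimp simp: quot_add V.a_comm)
  show "\<forall>v w x. v \<in> carrier ?Q \<and> w \<in> carrier ?Q \<and> x \<in> carrier ?Q \<longrightarrow>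
      v \<oplus>\<^bsub>?Q\<^esub> w \<oplus>\<^bsub>?Q\<^esub> x = v \<oplus>\<^bsub>?Q\<^esub> (w \<oplus>\<^bsub>?Q\<^esub> x)"
    unfolding quot_carrier by (clarsimp simp: quot_add V.a_assoc)
  show "\<forall>a b v. a \<in> carrier class_ring \<and> b \<in> carrier class_ring \<and> v \<in> carrier ?Q \<longrightarrow>
      (a \<otimes>\<^bsub>class_ring\<^esub> b) \<odot>\<^bsub>?Q\<^esub> v = a \<odot>\<^bsub>?Q\<^esub> (b \<odot>\<^bsub>?Q\<^esub> v)"
    unfolding quot_carrier by (clarsimp simp: quot_smult sc sa)
  show "\<forall>v\<in>carrier ?Q. \<one>\<^bsub>class_ring\<^esub> \<odot>\<^bsub>?Q\<^esub> v = v"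
    unfolding quot_carrier by (clarsimp simp: quot_smult one)
  show "\<forall>a b v. a \<in> carrier class_ring \<and> b \<in> carrier class_ring \<and> v \<in> carrier ?Q \<longrightarrow>
      (a \<oplus>\<^bsub>class_ring\<^esub> b) \<odot>\<^bsub>?Q\<^esub> v = (a \<odot>\<^bsub>?Q\<^esub> v) \<oplus>\<^bsub>?Q\<^esub> (b \<odot>\<^bsub>?Q\<^esub> v)"
    unfolding quot_carrier by (clarsimp simp: quot_smult quot_add sc dl)
  show "\<forall>a v w. a \<in> carrier class_ring \<and> v \<in> carrier ?Q \<and> w \<in> carrier ?Q \<longrightarrow>
      a \<odot>\<^bsub>?Q\<^esub> (v \<oplus>\<^bsub>?Q\<^esub> w) = (a \<odot>\<^bsub>?Q\<^esub> v) \<oplus>\<^bsub>?Q\<^esub> (a \<odot>\<^bsub>?Q\<^esub> w)"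
    unfolding quot_carrier by (clarsimp simp: quot_smult quot_add sc dr)
qed

lemma comb_quot:
  assumes "x ` J \<subseteq> carrier V" "finite J"
  shows "comb (quot_space V L) (\<lambda>i. quot_proj V L (x i)) J c = quot_proj V L (comb V x J c)"
  using assms quot_carrier quot_add quot_smult
  by (intro comb_hom[OF quot_vectorspace, symmetric]) auto

end

end

section \<open>Dependence in quotients as covering of cyclic sets\<close>

context relation_space
begin

text \<open>
  The family \<open>x\<close> stands for the projections of the points in \<open>J\<close> modulo the span of the points
  in \<open>W\<close>.  The condition says that its linear relations are exactly the relations in \<open>K\<close>
  supported in \<open>W \<union> J\<close>, with the coefficients on \<open>W\<close> forgotten.  This covers the
  first block, with \<open>W = {}\<close> in the ambient space, and the later blocks in their quotients.
\<close>

definition represents :: "('k, 'v) module \<Rightarrow> (nat \<Rightarrow> 'v) \<Rightarrow> nat set \<Rightarrow> nat set \<Rightarrow> bool" where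
  "represents V x W J \<longleftrightarrow> vectorspace class_ring V \<and> x ` J \<subseteq> carrier V \<and>
     (\<forall>J' c. J' \<subseteq> J \<longrightarrow> comb V x J' c = \<zero>\<^bsub>V\<^esub> \<longleftrightarrow> (\<exists>v\<in>rel (W \<union> J'). \<forall>i\<in>J'. v $ i = c i))"

context
  fixes V :: "('k, 'v) module" and x :: "nat \<Rightarrow> 'v" and W J :: "nat set"
  assumes rep: "represents V x W J" and W: "cyclic W" and disj: "W \<inter> J = {}" and J: "J \<subseteq> {..<n}"
begin

lemma comb_zero_iff:
  "J' \<subseteq> J \<Longrightarrow> comb V x J' c = \<zero>\<^bsub>V\<^esub> \<longleftrightarrow> (\<exists>v\<in>rel (W \<union> J'). \<forall>i\<in>J'. v $ i = c i)"
  using rep unfolding represents_def by blast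

lemma lin_dependent_iff:
  assumes "J' \<subseteq> J"
  shows "lin_dependent V x J' \<longleftrightarrow> (\<exists>v\<in>rel (W \<union> J'). \<exists>i\<in>J'. v $ i \<noteq> 0)"
proof
  assume "lin_dependent V x J'"
  then obtain c where "\<exists>i\<in>J'. c i \<noteq> 0" "\<exists>v\<in>rel (W \<union> J'). \<forall>i\<in>J'. v $ i = c i"
    unfolding lin_dependent_def comb_zero_iff[OF assms] by blast
  then show "\<exists>v\<in>rel (W \<union> J'). \<exists>i\<in>J'. v $ i \<noteq> 0" by metis
next
  assume "\<exists>v\<in>rel (W \<union> J'). \<exists>i\<in>J'. v $ i \<noteq> 0"
  then obtain v where "v \<in> rel (W \<union> J')" "\<exists>i\<in>J'. v $ i \<noteq> 0" by blast
  then show "lin_dependent V x J'"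
    unfolding lin_dependent_def comb_zero_iff[OF assms] by (intro exI[of _ "\<lambda>i. v $ i"]) blast
qed

lemma aff_dependent_iff:
  assumes "J' \<subseteq> J"
  shows "aff_dependent V x J' \<longleftrightarrow>
    (\<exists>v\<in>rel (W \<union> J'). coord_sum J' v = 0 \<and> (\<exists>i\<in>J'. v $ i \<noteq> 0))"
proof
  assume "aff_dependent V x J'"
  then obtain c where c: "\<exists>i\<in>J'. c i \<noteq> 0" "(\<Sum>i\<in>J'. c i) = 0"
    "\<exists>v\<in>rel (W \<union> J'). \<forall>i\<in>J'. v $ i = c i"
    unfolding aff_dependent_def comb_zero_iff[OF assms] by blast
  then obtain v where v: "v \<in> rel (W \<union> J')" "\<forall>i\<in>J'. v $ i = c i" by blast
  have "coord_sum J' v = 0" using c(2) v(2) unfolding coord_sum_def by simp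
  moreover have "\<exists>i\<in>J'. v $ i \<noteq> 0" using c(1) v(2) by simp
  ultimately show "\<exists>v\<in>rel (W \<union> J'). coord_sum J' v = 0 \<and> (\<exists>i\<in>J'. v $ i \<noteq> 0)"
    using v(1) by blast
next
  assume "\<exists>v\<in>rel (W \<union> J'). coord_sum J' v = 0 \<and> (\<exists>i\<in>J'. v $ i \<noteq> 0)"
  then obtain v where "v \<in> rel (W \<union> J')" "coord_sum J' v = 0" "\<exists>i\<in>J'. v $ i \<noteq> 0" by blast
  then show "aff_dependent V x J'"
    unfolding aff_dependent_def comb_zero_iff[OF assms] coord_sum_def
    by (intro exI[of _ "\<lambda>i. v $ i"]) blast
qed

lemma rel_supp_Int: "v \<in> rel (W \<union> J) \<Longrightarrow> v \<in> rel (W \<union> (supp v \<inter> J))"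
  by (auto simp: rel_def)

lemma in_supp: "v \<in> rel S \<Longrightarrow> i \<in> J \<Longrightarrow> v $ i \<noteq> 0 \<Longrightarrow> i \<in> supp v"
  using carrier_vecD[OF rel_carrier] J by (auto simp: supp_def)

lemma cyclic_of_supp:
  assumes "v \<in> rel (W \<union> J)" "supp v \<inter> J = J"
  shows "cyclic (W \<union> J)"
proof -
  have "W \<union> supp v = W \<union> J" using assms by (auto simp: rel_def)
  moreover have "cyclic (supp v)" using assms(1) by (auto simp: rel_def cyclic_def)
  ultimately show ?thesis using cyclic_Un[OF W] by metis
qed

text \<open>
  The support of an affine relation on a circuit meets all of \<open>J\<close>, by minimality.
\<close>

lemma circuit_imp_cyclic:
  assumes "circuit V x J"
  shows "cyclic (W \<union> J)"
proof -
  obtain v where v: "v \<in> rel (W \<union> J)" "coord_sum J v = 0" "\<exists>i\<in>J. v $ i \<noteq> 0"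
    using assms aff_dependent_iff[of J] unfolding circuit_def by blast
  let ?J = "supp v \<inter> J"
  have "coord_sum J v = coord_sum ?J v"
    unfolding coord_sum_def using J finite_subset in_supp[OF v(1)]
    by (intro sum.mono_neutral_right) auto
  then have "aff_dependent V x ?J"
    using v rel_supp_Int[OF v(1)] in_supp[OF v(1)] by (subst aff_dependent_iff) auto
  then have "\<not> ?J \<subset> J" using assms unfolding circuit_def by blast
  then show ?thesis using cyclic_of_supp[OF v(1)] by blast
qed

text \<open>
  Both sides say that \<open>K\<close> contains a relation on \<open>W \<union> J\<close> not supported in \<open>W\<close>, and that every such
  relation involves all of \<open>J\<close>.
\<close>

lemma min_lin_dependent_iff: "min_lin_dependent V x J \<longleftrightarrow> covers W (W \<union> J)"
proof
  assume min: "min_lin_dependent V x J"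
  have key: "supp v \<inter> J = J" if v: "v \<in> rel (W \<union> J)" "i \<in> J" "v $ i \<noteq> 0" for v i
  proof -
    have "lin_dependent V x (supp v \<inter> J)"
      using rel_supp_Int[OF v(1)] in_supp[OF v(1)] v by (subst lin_dependent_iff) auto
    then show ?thesis using min unfolding min_lin_dependent_def by blast
  qed
  obtain v i where v: "v \<in> rel (W \<union> J)" "i \<in> J" "v $ i \<noteq> 0"
    using min lin_dependent_iff[of J] unfolding min_lin_dependent_def by blast
  have "cyclic (W \<union> J)" using cyclic_of_supp[OF v(1) key[OF v]] .
  moreover have "W \<subset> W \<union> J" using v(2) disj by blast
  moreover have "R = W \<union> J" if R: "cyclic R" "W \<subset> R" "R \<subseteq> W \<union> J" for R
  proof -
    obtain w where w: "w \<in> K" "supp w = R" using R(1) by (auto simp: cyclic_def)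
    obtain k where k: "k \<in> J" "k \<in> R" using R(2,3) by blast
    have "supp w \<inter> J = J"
      using key[of w k] w k R(3) by (auto simp: rel_def supp_def)
    then show ?thesis using R(2,3) w(2) by blast
  qed
  ultimately show "covers W (W \<union> J)" unfolding covers_def using W by blast
next
  assume cov: "covers W (W \<union> J)"
  obtain v where v: "v \<in> K" "supp v = W \<union> J" using cov by (auto simp: covers_def cyclic_def)
  obtain i where i: "i \<in> J" using cov by (auto simp: covers_def)
  have "lin_dependent V x J"
    using v i by (subst lin_dependent_iff) (auto simp: rel_def supp_def)
  moreover have "\<not> lin_dependent V x J'" if J': "J' \<subset> J" for J'
  proof
    assume "lin_dependent V x J'"
    then obtain u k where u: "u \<in> rel (W \<union> J')" "k \<in> J'" "u $ k \<noteq> 0"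
      using lin_dependent_iff[of J'] J' by blast
    have kJ: "k \<in> J" using J' u(2) by blast
    have cyc: "cyclic (W \<union> supp u)"
      using u(1) by (intro cyclic_Un[OF W]) (auto simp: rel_def cyclic_def)
    have gt: "W \<subset> W \<union> supp u" using in_supp[OF u(1) kJ u(3)] disj kJ by blast
    have le: "W \<union> supp u \<subseteq> W \<union> J'" using u(1) by (simp add: rel_def)
    then have "W \<union> supp u \<subseteq> W \<union> J" using J' by blast
    then have "W \<union> supp u = W \<union> J" using cov cyc gt unfolding covers_def by simp
    then have "J \<subseteq> J'" using le disj by blast
    then show False using J' by blast
  qed
  ultimately show "min_lin_dependent V x J" unfolding min_lin_dependent_def by blast
qed

text \<open>
  The relations of the projected points form a line, so the affine ones among them form a
  space of dimension one if the step is affine, and of dimension zero otherwise.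
\<close>

lemma aff_dim_covers:
  assumes cov: "covers W (W \<union> J)"
  shows "aff_dim V x J = int (card J) - 1 - (if affine_step W (W \<union> J) then 1 else 0)"
proof -
  let ?D = "{c \<in> carrier_vec n. supp c \<subseteq> J \<and> coord_sum J c = 0 \<and> comb V x J (\<lambda>i. c $ i) = \<zero>\<^bsub>V\<^esub>}"
  have diff: "W \<union> J - W = J" using disj by blast
  obtain e where e: "e \<in> J" using cov by (auto simp: covers_def)
  then have en: "e < n" and eW: "e \<in> W \<union> J - W" using J disj by auto
  have D: "c \<in> ?D \<longleftrightarrow> c \<in> carrier_vec n \<and> supp c \<subseteq> J \<and> coord_sum J c = 0 \<and>
      (\<exists>v\<in>rel (W \<union> J). \<forall>i\<in>J. v $ i = c $ i)" for c
    using comb_zero_iff[of J] by simp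
  have Vv: "vectorspace class_ring V" and xJ: "x ` J \<subseteq> carrier V"
    using rep by (auto simp: represents_def)
  have dimD: "aff_dim V x J = int (card J) - 1 - int (subspace_dim n ?D)"
    using e by (intro aff_dim_eq[OF Vv J _ xJ]) blast
  have sub: "lin_subspace n ?D"
  proof -
    let ?U = "{c \<in> carrier_vec n. supp c \<subseteq> J} :: 'k vec set"
    note U = lin_subspaceD[OF subspace_dim_support(1)[OF J, where ?'k = 'k]]
    note R = lin_subspaceD[OF rel_subspace[of "W \<union> J"]]
    show ?thesis
      unfolding lin_subspace_iff
    proof (intro conjI ballI allI)
      show "?D \<subseteq> carrier_vec n" by blast
      have "coord_sum J (0\<^sub>v n :: 'k vec) = 0"
        unfolding coord_sum_def using J by (intro sum.neutral) auto
      then show "0\<^sub>v n \<in> ?D"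
        unfolding D using R(2) by (auto simp: supp_def intro!: bexI[of _ "0\<^sub>v n"])
    next
      fix c d assume c: "c \<in> ?D" and d: "d \<in> ?D"
      obtain v w where v: "v \<in> rel (W \<union> J)" "\<forall>i\<in>J. v $ i = c $ i"
        and w: "w \<in> rel (W \<union> J)" "\<forall>i\<in>J. w $ i = d $ i"
        using c d unfolding D by blast
      have car: "c \<in> carrier_vec n" "d \<in> carrier_vec n" "v \<in> carrier_vec n" "w \<in> carrier_vec n"
        using c d v(1) w(1) R(1) by auto
      have "c + d \<in> ?U" using c d U(3)[of c d] by blast
      moreover have "coord_sum J (c + d) = 0"
        using coord_sum_add[OF car(1,2) J] c d by simp
      moreover have "\<forall>i\<in>J. (v + w) $ i = (c + d) $ i" using v w car J by auto
      ultimately show "c + d \<in> ?D" unfolding D using R(3)[OF v(1) w(1)] by blast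
    next
      fix a c assume c: "c \<in> ?D"
      obtain v where v: "v \<in> rel (W \<union> J)" "\<forall>i\<in>J. v $ i = c $ i"
        using c unfolding D by blast
      have car: "c \<in> carrier_vec n" "v \<in> carrier_vec n" using c v(1) R(1) by auto
      have "a \<cdot>\<^sub>v c \<in> ?U" using c U(4)[of c a] by blast
      moreover have "coord_sum J (a \<cdot>\<^sub>v c) = 0"
        using coord_sum_smult[OF car(1) J, of a] c by simp
      moreover have "\<forall>i\<in>J. (a \<cdot>\<^sub>v v) $ i = (a \<cdot>\<^sub>v c) $ i" using v car J by auto
      ultimately show "a \<cdot>\<^sub>v c \<in> ?D" unfolding D using R(4)[OF v(1)] by blast
    qed
  qed
  have cut: "{c \<in> ?D. c $ e = 0} = {0\<^sub>v n}"
  proof (intro equalityI subsetI)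
    fix c assume c: "c \<in> {c \<in> ?D. c $ e = 0}"
    then have cD: "c \<in> ?D" by blast
    obtain v where v: "v \<in> rel (W \<union> J)" "\<forall>i\<in>J. v $ i = c $ i"
      using cD unfolding D by blast
    have "v $ e = 0" using v(2) e c by auto
    then have vW: "v \<in> rel W" using rel_covers[OF cov eW] v(1) by simp
    have "c $ i = 0" if "i < n" for i
    proof (cases "i \<in> J")
      case True
      then have "i \<notin> W" using disj by blast
      then show ?thesis using v(2) True rel_coord[OF vW that] by simp
    next
      case False
      then show ?thesis using cD that by (auto simp: supp_def)
    qed
    then show "c \<in> {0\<^sub>v n}" using cD by (auto simp: vec_eq_iff)
  next
    fix c :: "'k vec" assume "c \<in> {0\<^sub>v n}"
    then show "c \<in> {c \<in> ?D. c $ e = 0}" using lin_subspaceD(2)[OF sub] en by simp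
  qed
  have aff: "(\<exists>c\<in>?D. c $ e \<noteq> 0) \<longleftrightarrow> affine_step W (W \<union> J)"
  proof
    assume "\<exists>c\<in>?D. c $ e \<noteq> 0"
    then obtain c where c: "c \<in> ?D" "c $ e \<noteq> 0" by blast
    obtain v where v: "v \<in> rel (W \<union> J)" "\<forall>i\<in>J. v $ i = c $ i"
      using c(1) unfolding D by blast
    have "coord_sum J v = 0" using c(1) v(2) by (simp add: coord_sum_def)
    then show "affine_step W (W \<union> J)"
      using affine_step_witness[OF cov v(1) _ eW] v(2) e c(2) diff by simp
  next
    assume st: "affine_step W (W \<union> J)"
    obtain v where v: "v \<in> K" "supp v = W \<union> J" using cov by (auto simp: covers_def cyclic_def)
    then have vr: "v \<in> rel (W \<union> J)" by (simp add: rel_def)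
    let ?c = "vec n (\<lambda>i. if i \<in> J then v $ i else 0)"
    have on: "\<forall>i\<in>J. v $ i = ?c $ i" using J by auto
    have "coord_sum J ?c = coord_sum J v" unfolding coord_sum_def using on by simp
    then have "coord_sum J ?c = 0" using st vr diff by (simp add: affine_step_def)
    moreover have "supp ?c \<subseteq> J" by (auto simp: supp_def split: if_splits)
    ultimately have "?c \<in> ?D" unfolding D using vr on by auto
    moreover have "?c $ e \<noteq> 0" using v(2) e en by (auto simp: supp_def)
    ultimately show "\<exists>c\<in>?D. c $ e \<noteq> 0" by blast
  qed
  have "subspace_dim n ?D = subspace_dim n {c \<in> ?D. c $ e = 0} + (if \<exists>c\<in>?D. c $ e \<noteq> 0 then 1 else 0)"
    by (rule subspace_dim_coordinate(2)[OF sub en])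
  then have "subspace_dim n ?D = (if affine_step W (W \<union> J) then 1 else 0)"
    unfolding cut aff by simp
  then show ?thesis unfolding dimD by simp
qed

text \<open>
  Two equal points are affinely dependent, hence by minimality they are all of \<open>J\<close>.  This matches
  the alternative between injectivity and circuits of dimension zero in the definition of iterated
  circuits.
\<close>

lemma equal_points_circuit:
  assumes cov: "covers W (W \<union> J)" and ninj: "\<not> inj_on x J"
  shows "circuit V x J \<and> aff_dim V x J = 0"
proof -
  obtain i k where ik: "i \<in> J" "k \<in> J" "i \<noteq> k" "x i = x k"
    using ninj unfolding inj_on_def by blast
  have Vv: "vectorspace class_ring V" and xJ: "x ` J \<subseteq> carrier V"
    using rep by (auto simp: represents_def)
  interpret V: vectorspace class_ring V by (rule Vv)
  have xk: "x k \<in> carrier V" using xJ ik by blast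
  let ?c = "\<lambda>l. if l = i then 1 else (- 1 :: 'k)"
  have "comb V x {i, k} ?c = (1 \<odot>\<^bsub>V\<^esub> x k) \<oplus>\<^bsub>V\<^esub> (((- 1) \<odot>\<^bsub>V\<^esub> x k) \<oplus>\<^bsub>V\<^esub> \<zero>\<^bsub>V\<^esub>)"
    using comb_insert[OF Vv, of "{k}" i x ?c] comb_insert[OF Vv, of "{}" k x ?c]
      comb_empty[OF Vv, of x ?c] ik xk by simp
  also have "\<dots> = x k \<oplus>\<^bsub>V\<^esub> (\<ominus>\<^bsub>V\<^esub> x k)"
    using V.smult_one[OF xk] V.smult_minus_1[OF xk] xk by (simp add: class_ring_simps)
  also have "\<dots> = \<zero>\<^bsub>V\<^esub>" using V.r_neg[OF xk] .
  finally have aff_ik: "aff_dependent V x {i, k}"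
    unfolding aff_dependent_def using ik(3) by (intro exI[of _ ?c]) auto
  have aff_lin: "lin_dependent V x J'" if "aff_dependent V x J'" for J'
    using that unfolding aff_dependent_def lin_dependent_def by blast
  have min: "\<not> lin_dependent V x J'" if "J' \<subset> J" for J'
    using min_lin_dependent_iff cov that unfolding min_lin_dependent_def by simp
  have eq: "J = {i, k}"
    using min[of "{i, k}"] aff_lin[OF aff_ik] ik(1,2) by blast
  then have affJ: "aff_dependent V x J" using aff_ik by simp
  have "circuit V x J"
    unfolding circuit_def using affJ aff_lin min by blast
  moreover obtain v l where v: "v \<in> rel (W \<union> J)" "coord_sum J v = 0" "l \<in> J" "v $ l \<noteq> 0"
    using affJ aff_dependent_iff[of J] by blast
  have "W \<union> J - W = J" using disj by blast
  then have "affine_step W (W \<union> J)"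
    using affine_step_witness[OF cov v(1), of l] v by simp
  then have "aff_dim V x J = 0"
    using aff_dim_covers[OF cov] eq ik(3) by simp
  ultimately show ?thesis by blast
qed

end

text \<open>
  Without a quotient, every linear relation is affine, so circuits and minimally linearly dependent
  sets coincide.
\<close>

lemma circuit_iff_covers:
  assumes rep: "represents V x {} J" and J: "J \<subseteq> {..<n}"
  shows "circuit V x J \<longleftrightarrow> covers {} J"
proof -
  note ctx = rep cyclic_empty Int_empty_left J
  have "aff_dependent V x J' \<longleftrightarrow> lin_dependent V x J'" if "J' \<subseteq> J" for J'
    unfolding aff_dependent_iff[OF ctx that] lin_dependent_iff[OF ctx that]
    using rel_sum_zero[of _ J'] that J by auto
  then have "circuit V x J \<longleftrightarrow> min_lin_dependent V x J"
    unfolding circuit_def min_lin_dependent_def by blast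
  then show ?thesis using min_lin_dependent_iff[OF ctx] by simp
qed

end

section \<open>The columns of a matrix as a configuration\<close>

context configuration
begin

abbreviation image_of :: "nat set \<Rightarrow> 'k vec set" where
  "image_of S \<equiv> (\<lambda>v. A *\<^sub>v v) ` {v \<in> carrier_vec n. supp v \<subseteq> S}"

lemma ambient_eq: "ambient A = module_vec TYPE('k) r"
  using A_carrier by simp

lemma col_carrier: "i < n \<Longrightarrow> col A i \<in> carrier_vec r"
  using A_carrier by auto

lemma comb_ambient:
  assumes J: "J \<subseteq> {..<n}"
  shows "comb (ambient A) (col A) J c = A *\<^sub>v vec n (\<lambda>i. if i \<in> J then c i else 0)"
proof -
  interpret N: vec_space "TYPE('k)" n .
  interpret R: vectorspace class_ring "module_vec TYPE('k) r" by (rule vec_vs)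
  have nv: "vectorspace class_ring N.V" and rv: "vectorspace class_ring (ambient A)"
    by (rule vec_vs)+
  have fin: "finite J" using J finite_subset by blast
  have un: "unit_vec n ` J \<subseteq> carrier N.V" by (auto simp: module_vec_simps)
  have "A *\<^sub>v comb N.V (unit_vec n) J c = comb (ambient A) (\<lambda>i. A *\<^sub>v unit_vec n i) J c"
    unfolding ambient_eq
    by (rule comb_hom[OF nv vec_vs _ _ _ un fin])
      (use A_carrier in \<open>auto simp: module_vec_simps mult_add_distrib_mat_vec[OF A_carrier]
        mult_mat_vec[OF A_carrier]\<close>)
  also have "\<dots> = comb (ambient A) (col A) J c"
  proof -
    have "A *\<^sub>v unit_vec n i = col A i" if "i \<in> J" for i
      using that J mult_mat_unit_vec[OF A_carrier] by blast
    then show ?thesis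
      unfolding comb_def ambient_eq
      using col_carrier J by (intro R.finsum_cong') (auto simp: module_vec_simps)
  qed
  also have "comb N.V (unit_vec n) J c = vec n (\<lambda>i. if i \<in> J then c i else 0)"
    using fin J
  proof (induction J rule: finite_induct)
    case empty
    show ?case using comb_empty[OF nv] by (auto simp: vec_eq_iff module_vec_simps)
  next
    case (insert j J)
    have "unit_vec n ` insert j J \<subseteq> carrier N.V" by (auto simp: module_vec_simps)
    then show ?case
      using comb_insert[OF nv insert.hyps(1,2)] insert.IH insert.prems insert.hyps(2)
      by (auto simp: vec_eq_iff module_vec_simps)
  qed
  finally show ?thesis by simp
qed

text \<open>
  The spans of sets of points are described as images under \<open>A\<close>, which makes membership in the
  span a statement about coefficient vectors.
\<close>

lemma image_of_subspace: "lin_subspace r (image_of S)"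
proof -
  have S: "lin_subspace n {v \<in> carrier_vec n :: 'k vec set. supp v \<subseteq> S}"
  proof -
    have "{v \<in> carrier_vec n :: 'k vec set. supp v \<subseteq> S \<inter> {..<n}} = {v \<in> carrier_vec n. supp v \<subseteq> S}"
      using supp_subset by blast
    then show ?thesis
      using subspace_dim_support(1)[of "S \<inter> {..<n}" n, where ?'k = 'k] by simp
  qed
  show ?thesis
    unfolding lin_subspace_iff
  proof (intro conjI ballI allI)
    show "image_of S \<subseteq> carrier_vec r" using A_carrier by auto
    show "0\<^sub>v r \<in> image_of S"
      using lin_subspaceD(2)[OF S] A_carrier by (intro image_eqI[of _ _ "0\<^sub>v n"]) auto
  next
    fix a b assume "a \<in> image_of S" "b \<in> image_of S"
    then obtain v w where v: "v \<in> carrier_vec n" "supp v \<subseteq> S" "a = A *\<^sub>v v"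
      and w: "w \<in> carrier_vec n" "supp w \<subseteq> S" "b = A *\<^sub>v w" by blast
    have "a + b = A *\<^sub>v (v + w)"
      unfolding v(3) w(3) by (rule mult_add_distrib_mat_vec[OF A_carrier v(1) w(1), symmetric])
    moreover have "v + w \<in> {v \<in> carrier_vec n. supp v \<subseteq> S}"
      by (rule lin_subspaceD(3)[OF S]) (use v w in auto)
    ultimately show "a + b \<in> image_of S" by (rule image_eqI)
  next
    fix c a assume "a \<in> image_of S"
    then obtain v where v: "v \<in> carrier_vec n" "supp v \<subseteq> S" "a = A *\<^sub>v v" by blast
    have "c \<cdot>\<^sub>v a = A *\<^sub>v (c \<cdot>\<^sub>v v)"
      unfolding v(3) by (rule mult_mat_vec[OF A_carrier v(1), symmetric])
    moreover have "c \<cdot>\<^sub>v v \<in> {v \<in> carrier_vec n. supp v \<subseteq> S}"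
      by (rule lin_subspaceD(4)[OF S]) (use v in auto)
    ultimately show "c \<cdot>\<^sub>v a \<in> image_of S" by (rule image_eqI)
  qed
qed

lemma lin_span_eq:
  assumes J: "J \<subseteq> {..<n}"
  shows "lin_span (ambient A) (col A) J = image_of J"
proof -
  interpret R: vec_space "TYPE('k)" r .
  have colJ: "col A ` J \<subseteq> carrier_vec r" using J col_carrier by auto
  have span: "lin_subspace r (R.span (col A ` J))" by (rule R.span_is_submodule[OF colJ])
  have sub: "R.span (col A ` J) \<subseteq> image_of J"
  proof (rule R.span_is_subset[OF _ image_of_subspace])
    show "col A ` J \<subseteq> image_of J"
    proof
      fix a assume "a \<in> col A ` J"
      then obtain j where j: "j \<in> J" "a = col A j" by blast
      have "j < n" using j(1) J by blast
      then have "a = A *\<^sub>v unit_vec n j" unfolding j(2) by (rule mult_mat_unit_vec[OF A_carrier, symmetric])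
      moreover have "supp (unit_vec n j :: 'k vec) \<subseteq> J"
        using j(1) \<open>j < n\<close> by (auto simp: supp_def unit_vec_def split: if_splits)
      then have "unit_vec n j \<in> {v \<in> carrier_vec n :: 'k vec set. supp v \<subseteq> J}" by simp
      ultimately show "a \<in> image_of J" by (rule image_eqI)
    qed
  qed
  have "A *\<^sub>v v \<in> R.span (col A ` J)" if v: "v \<in> carrier_vec n" "supp v \<subseteq> J" for v
  proof -
    have sv: "vectorspace class_ring (R.V\<lparr>carrier := R.span (col A ` J)\<rparr>)"
      by (rule vectorspace_lin_subspace[OF span])
    have inS: "col A ` J \<subseteq> carrier (R.V\<lparr>carrier := R.span (col A ` J)\<rparr>)"
      using R.in_own_span[OF colJ] by simp
    have fin: "finite J" using J finite_subset by blast
    have "comb (R.V\<lparr>carrier := R.span (col A ` J)\<rparr>) (col A) J (\<lambda>i. v $ i)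
        = comb R.V (\<lambda>i. col A i) J (\<lambda>i. v $ i)"
      by (rule comb_hom[OF sv R.vectorspace_axioms, where f = "\<lambda>v. v"])
        (use inS fin lin_subspaceD(1)[OF span] in auto)
    also have "\<dots> = A *\<^sub>v vec n (\<lambda>i. if i \<in> J then v $ i else 0)"
      using comb_ambient[OF J] unfolding ambient_eq by simp
    also have "vec n (\<lambda>i. if i \<in> J then v $ i else 0) = v"
      using v by (auto simp: vec_eq_iff supp_def)
    finally show ?thesis
      using comb_closed[OF sv inS, of "\<lambda>i. v $ i"] by simp
  qed
  then show ?thesis
    using sub unfolding lin_span_def ambient_eq by blast
qed

lemma represents_ambient:
  assumes J: "J \<subseteq> {..<n}"
  shows "represents (ambient A) (col A) {} J"
  unfolding represents_def
proof (intro conjI allI impI)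
  show "vectorspace class_ring (ambient A)" by (rule vec_vs)
  show "col A ` J \<subseteq> carrier (ambient A)"
    using J col_carrier unfolding ambient_eq by (auto simp: module_vec_simps)
  fix J' c assume J': "J' \<subseteq> J"
  let ?c = "vec n (\<lambda>i. if i \<in> J' then c i else 0) :: 'k vec"
  have J'n: "J' \<subseteq> {..<n}" using J' J by blast
  have supp: "supp ?c \<subseteq> J'" by (auto simp: supp_def split: if_splits)
  have "comb (ambient A) (col A) J' c = \<zero>\<^bsub>ambient A\<^esub> \<longleftrightarrow> ?c \<in> mat_kernel A"
    unfolding comb_ambient[OF J'n] mat_kernel[OF A_carrier] unfolding ambient_eq
    by (simp add: module_vec_simps)
  also have "\<dots> \<longleftrightarrow> (\<exists>v\<in>rel ({} \<union> J'). \<forall>i\<in>J'. v $ i = c i)"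
  proof
    assume "?c \<in> mat_kernel A"
    then show "\<exists>v\<in>rel ({} \<union> J'). \<forall>i\<in>J'. v $ i = c i"
      using supp J'n by (intro bexI[of _ ?c]) (auto simp: rel_def)
  next
    assume "\<exists>v\<in>rel ({} \<union> J'). \<forall>i\<in>J'. v $ i = c i"
    then obtain v where v: "v \<in> rel J'" "\<forall>i\<in>J'. v $ i = c i" by auto
    have "?c = v"
      using v rel_coord[OF v(1)] carrier_vecD[OF rel_carrier[OF v(1)]] by (auto simp: vec_eq_iff)
    then show "?c \<in> mat_kernel A" using v(1) by (simp add: rel_def)
  qed
  finally show "comb (ambient A) (col A) J' c = \<zero>\<^bsub>ambient A\<^esub> \<longleftrightarrow>
    (\<exists>v\<in>rel ({} \<union> J'). \<forall>i\<in>J'. v $ i = c i)" .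
qed

text \<open>
  A combination of the points of \<open>J\<close> lies in the span of those of \<open>W\<close> if and only if subtracting
  a suitable combination of the latter gives a vector of the kernel of \<open>A\<close>.  As \<open>W\<close> and \<open>J\<close> are
  disjoint, this does not change the coefficients on \<open>J\<close>.
\<close>

lemma represents_quotient:
  assumes U: "\<Union>(set Is) \<subseteq> {..<n}" and j: "j < length Is"
    and disj: "\<Union>(set (take j Is)) \<inter> Is ! j = {}"
  shows "represents (ic_quot A Is j) (ic_proj A Is j) (\<Union>(set (take j Is))) (Is ! j)"
proof -
  let ?U = "\<Union>(set Is)" and ?W = "\<Union>(set (take j Is))" and ?J = "Is ! j"
  let ?V = "(module_vec TYPE('k) r)\<lparr>carrier := image_of ?U\<rparr>" and ?L = "image_of ?W"
  have WU: "?W \<subseteq> ?U" using set_take_subset[of j Is] by blast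
  have JU: "?J \<subseteq> ?U" using j nth_mem by blast
  have Wn: "?W \<subseteq> {..<n}" using WU U by blast
  have space: "ic_space A Is = ?V"
    unfolding ic_space_def lin_span_eq[OF U] unfolding ambient_eq ..
  have sub: "ic_sub A Is j = ?L"
    unfolding ic_sub_def lin_span_eq[OF Wn] ..
  have Vv: "vectorspace class_ring ?V"
    by (rule vectorspace_lin_subspace[OF image_of_subspace])
  have rv: "vectorspace class_ring (ambient A)" by (rule vec_vs)
  have LV: "submodule class_ring ?L ?V"
  proof -
    have "module class_ring ?V" using Vv by (simp add: vectorspace_def)
    moreover have "?L \<subseteq> image_of ?U" using WU by blast
    ultimately show ?thesis
      using image_of_subspace[of ?W] unfolding submodule_def by auto
  qed
  have colU: "col A ` ?U \<subseteq> carrier ?V"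
  proof -
    interpret R: vec_space "TYPE('k)" r .
    have "col A ` ?U \<subseteq> carrier_vec r" using U col_carrier by auto
    then show ?thesis
      using R.in_own_span[of "col A ` ?U"] lin_span_eq[OF U] unfolding lin_span_def ambient_eq by simp
  qed
  show ?thesis
    unfolding represents_def ic_quot_def ic_proj_def space sub
  proof (intro conjI allI impI)
    show "vectorspace class_ring (quot_space ?V ?L)" by (rule quot_vectorspace[OF Vv LV])
    show "(\<lambda>i. quot_proj ?V ?L (col A i)) ` ?J \<subseteq> carrier (quot_space ?V ?L)"
      unfolding quot_carrier[OF Vv LV] using colU JU by blast
    fix J' c assume J': "J' \<subseteq> ?J"
    let ?c = "vec n (\<lambda>i. if i \<in> J' then c i else 0) :: 'k vec"
    have J'n: "J' \<subseteq> {..<n}" using J' JU U by blast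
    have fin: "finite J'" using J'n finite_subset by blast
    have colJ': "col A ` J' \<subseteq> carrier ?V" using colU J' JU by blast
    have supp: "supp ?c \<subseteq> J'" by (auto simp: supp_def split: if_splits)
    have "comb ?V (col A) J' c = comb (ambient A) (\<lambda>i. col A i) J' c"
      by (rule comb_hom[OF Vv rv, where f = "\<lambda>v. v"])
        (use colJ' fin lin_subspaceD(1)[OF image_of_subspace, of _ ?U] in
          \<open>auto simp: ambient_eq module_vec_simps\<close>)
    then have cV: "comb ?V (col A) J' c = A *\<^sub>v ?c"
      using comb_ambient[OF J'n] by simp
    have "comb (quot_space ?V ?L) (\<lambda>i. quot_proj ?V ?L (col A i)) J' c
        = \<zero>\<^bsub>quot_space ?V ?L\<^esub> \<longleftrightarrow> A *\<^sub>v ?c \<in> ?L"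
      unfolding comb_quot[OF Vv LV colJ' fin] quot_zero[OF Vv LV]
      using quot_proj_zero_iff[OF Vv LV comb_closed[OF Vv colJ', of c]] unfolding cV .
    also have "\<dots> \<longleftrightarrow> (\<exists>v\<in>rel (?W \<union> J'). \<forall>i\<in>J'. v $ i = c i)"
    proof
      assume "A *\<^sub>v ?c \<in> ?L"
      then obtain u where u: "u \<in> carrier_vec n" "supp u \<subseteq> ?W" "A *\<^sub>v ?c = A *\<^sub>v u" by blast
      let ?v = "?c - u"
      have car: "?c \<in> carrier_vec n" by simp
      have "A *\<^sub>v ?v = 0\<^sub>v r"
        using mult_minus_distrib_mat_vec[OF A_carrier car u(1)] u(3) A_carrier u(1) by simp
      then have "?v \<in> mat_kernel A" using u(1) unfolding mat_kernel[OF A_carrier] by simp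
      moreover have "supp ?v \<subseteq> ?W \<union> J'"
        using supp_diff[OF car u(1)] supp u(2) by blast
      moreover have "\<forall>i\<in>J'. ?v $ i = c i"
      proof
        fix i assume i: "i \<in> J'"
        then have "i \<notin> supp u" using u(2) J' disj by blast
        moreover have "i < n" using i J'n by blast
        ultimately show "?v $ i = c i" using i u(1) by (simp add: supp_def)
      qed
      ultimately show "\<exists>v\<in>rel (?W \<union> J'). \<forall>i\<in>J'. v $ i = c i"
        unfolding rel_def by blast
    next
      assume "\<exists>v\<in>rel (?W \<union> J'). \<forall>i\<in>J'. v $ i = c i"
      then obtain v where v: "v \<in> rel (?W \<union> J')" "\<forall>i\<in>J'. v $ i = c i" by blast
      have vc: "v \<in> carrier_vec n" "A *\<^sub>v v = 0\<^sub>v r"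
        using v(1) mat_kernelD[OF A_carrier, of v] by (simp_all add: rel_def)
      let ?u = "?c - v"
      have car: "?c \<in> carrier_vec n" by simp
      have "?u \<in> carrier_vec n" using vc(1) by simp
      moreover have zero: "?u $ i = 0" if "i < n" "i \<notin> ?W" for i
        using v(2) rel_coord[OF v(1) that(1)] that vc(1) by (cases "i \<in> J'") simp_all
      have "supp ?u \<subseteq> ?W"
      proof
        fix i assume "i \<in> supp ?u"
        then have "i < n" "?u $ i \<noteq> 0" using vc(1) unfolding supp_def by auto
        then show "i \<in> ?W" using zero by blast
      qed
      moreover have "A *\<^sub>v ?u = A *\<^sub>v ?c"
        using mult_minus_distrib_mat_vec[OF A_carrier car vc(1)] vc A_carrier by simp
      ultimately show "A *\<^sub>v ?c \<in> ?L" by (intro image_eqI[of _ _ ?u]) simp_all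
    qed
    finally show "comb (quot_space ?V ?L) (\<lambda>i. quot_proj ?V ?L (col A i)) J' c
        = \<zero>\<^bsub>quot_space ?V ?L\<^esub> \<longleftrightarrow> (\<exists>v\<in>rel (?W \<union> J'). \<forall>i\<in>J'. v $ i = c i)" .
  qed
qed

section \<open>Iterated circuits and flags\<close>

abbreviation block_union :: "nat set list \<Rightarrow> nat \<Rightarrow> nat set" where
  "block_union Is j \<equiv> \<Union>(set (take j Is))"

definition block_dim :: "nat set list \<Rightarrow> nat \<Rightarrow> int" where
  "block_dim Is j = (if j = 0 then aff_dim (ambient A) (col A) (Is ! 0)
     else aff_dim (ic_quot A Is j) (ic_proj A Is j) (Is ! j))"

lemma block_union_Suc: "j < length Is \<Longrightarrow> block_union Is (Suc j) = block_union Is j \<union> Is ! j"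
  by (simp add: take_Suc_conv_app_nth Un_commute)

lemma eta_eq_sum_block_dim: "Is \<noteq> [] \<Longrightarrow> eta A Is = (\<Sum>j<length Is. block_dim Is j)"
proof -
  assume "Is \<noteq> []"
  then have "{..<length Is} = insert 0 {1..<length Is}" by auto
  then have "(\<Sum>j<length Is. block_dim Is j) = block_dim Is 0 + (\<Sum>j = 1..<length Is. block_dim Is j)"
    by simp
  also have "(\<Sum>j = 1..<length Is. block_dim Is j) =
      (\<Sum>j = 1..<length Is. aff_dim (ic_quot A Is j) (ic_proj A Is j) (Is ! j))"
    by (intro sum.cong) (auto simp: block_dim_def)
  finally show ?thesis by (simp add: eta_def block_dim_def)
qed

lemma flag_score_Cons_union:
  assumes "W = flag_top Ts" "covers W (W \<union> J)" "W \<inter> J = {}"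
  shows "flag_score ((W \<union> J) # Ts) =
    flag_score Ts + (int (card J) - 1 - (if affine_step W (W \<union> J) then 1 else 0))"
proof -
  have "finite (W \<union> J)" using assms(2) cyclic_finite by (auto simp: covers_def)
  then have "card (W \<union> J) = card W + card J" using assms(3) by (simp add: card_Un_disjoint)
  then show ?thesis using assms(1) by (simp add: flag_score_def)
qed

text \<open>
  A block whose projection is minimally dependent is a covering step.  A circuit of dimension zero
  may consist of two points projected to zero, which form no covering step; but since it
  adds nothing to \<open>\<eta>\<close>, any refinement into covering steps will do, each having a nonnegative
  contribution.
\<close>

lemma iterated_circuit_flag:
  assumes ic: "iterated_circuit A Is" and j: "j \<le> length Is"
  shows "\<exists>Ts. flag Ts \<and> flag_top Ts = block_union Is j \<and> (\<Sum>i<j. block_dim Is i) \<le> flag_score Ts"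
  using j
proof (induction j)
  case 0
  show ?case by (intro exI[of _ "[]"]) (simp add: flag_Nil flag_score_def)
next
  case (Suc j)
  then obtain Ts where Ts: "flag Ts" "flag_top Ts = block_union Is j"
    "(\<Sum>i<j. block_dim Is i) \<le> flag_score Ts" by auto
  let ?W = "block_union Is j" and ?J = "Is ! j"
  have j: "j < length Is" using Suc.prems by simp
  have U: "\<Union>(set Is) \<subseteq> {..<n}" and pd: "\<And>i. i < j \<Longrightarrow> Is ! i \<inter> Is ! j = {}"
    using ic j carrier_matD(2)[OF A_carrier] unfolding iterated_circuit_def by auto
  have disj: "?W \<inter> ?J = {}"
  proof -
    have "S \<inter> ?J = {}" if S: "S \<in> set (take j Is)" for S
    proof -
      obtain i where "i < j" "S = Is ! i" using S j by (auto simp: in_set_conv_nth)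
      then show ?thesis using pd[of i] by simp
    qed
    then show ?thesis by blast
  qed
  have Jn: "?J \<subseteq> {..<n}" using U j nth_mem by blast
  have W: "cyclic ?W" using flag_top_cyclic[OF Ts(1)] Ts(2) by simp
  have union: "block_union Is (Suc j) = ?W \<union> ?J" by (rule block_union_Suc[OF j])
  have step: ?case if cov: "covers ?W (?W \<union> ?J)"
      and dim: "block_dim Is j = int (card ?J) - 1 - (if affine_step ?W (?W \<union> ?J) then 1 else 0)"
  proof (intro exI conjI)
    show "flag ((?W \<union> ?J) # Ts)" using Ts(1,2) cov flag.flag_Cons by metis
    show "flag_top ((?W \<union> ?J) # Ts) = block_union Is (Suc j)" using union by simp
    show "(\<Sum>i<Suc j. block_dim Is i) \<le> flag_score ((?W \<union> ?J) # Ts)"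
      using flag_score_Cons_union[OF Ts(2)[symmetric] cov disj] dim Ts(3) by simp
  qed
  show ?case
  proof (cases "j = 0")
    case True
    have J0: "Is ! 0 \<subseteq> {..<n}" using Jn True by simp
    note rep = represents_ambient[OF J0]
    have "circuit (ambient A) (col A) (Is ! 0)" using ic by (simp add: iterated_circuit_def)
    then have cov: "covers {} ({} \<union> Is ! 0)" using circuit_iff_covers[OF rep J0] by simp
    show ?thesis
    proof (rule step)
      show "covers ?W (?W \<union> ?J)" using cov True by simp
      show "block_dim Is j = int (card ?J) - 1 - (if affine_step ?W (?W \<union> ?J) then 1 else 0)"
        using aff_dim_covers[OF rep cyclic_empty Int_empty_left J0 cov] True
        by (simp add: block_dim_def)
    qed
  next
    case False
    note ctx = represents_quotient[OF U j disj] W disj Jn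
    have dim: "block_dim Is j = aff_dim (ic_quot A Is j) (ic_proj A Is j) ?J"
      using False by (simp add: block_dim_def)
    have "j \<in> {1..<length Is}" using False j by simp
    then consider
      "circuit (ic_quot A Is j) (ic_proj A Is j) ?J" "aff_dim (ic_quot A Is j) (ic_proj A Is j) ?J = 0"
      | "min_lin_dependent (ic_quot A Is j) (ic_proj A Is j) ?J"
      using ic unfolding iterated_circuit_def by blast
    then show ?thesis
    proof cases
      case 1
      have "cyclic (?W \<union> ?J)" by (rule circuit_imp_cyclic[OF ctx 1(1)])
      then obtain Ts' where "flag Ts'" "flag_top Ts' = ?W \<union> ?J" "flag_score Ts \<le> flag_score Ts'"
        using flag_extend[OF Ts(1), of "?W \<union> ?J"] Ts(2) by auto
      then show ?thesis using Ts(3) dim 1(2) union by (intro exI[of _ Ts']) simp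
    next
      case 2
      then have cov: "covers ?W (?W \<union> ?J)" using min_lin_dependent_iff[OF ctx] by simp
      then show ?thesis using step aff_dim_covers[OF ctx cov] dim by simp
    qed
  qed
qed

fun blocks :: "nat set list \<Rightarrow> nat set list" where
  "blocks [] = []"
| "blocks (T # Ts) = blocks Ts @ [T - flag_top Ts]"

lemma length_blocks [simp]: "length (blocks Ts) = length Ts"
  by (induction Ts) auto

lemma Union_blocks: "flag Ts \<Longrightarrow> \<Union>(set (blocks Ts)) = flag_top Ts"
proof (induction Ts rule: flag.induct)
  case (flag_Cons Ts T)
  then show ?case by (auto simp: covers_def)
qed simp

lemma blocks_covers:
  "flag Ts \<Longrightarrow> j < length Ts \<Longrightarrow>
    covers (block_union (blocks Ts) j) (block_union (blocks Ts) j \<union> blocks Ts ! j) \<and>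
    block_union (blocks Ts) j \<inter> blocks Ts ! j = {}"
proof (induction Ts rule: flag.induct)
  case (flag_Cons Ts T)
  show ?case
  proof (cases "j < length Ts")
    case True
    then show ?thesis using flag_Cons by (simp add: nth_append)
  next
    case False
    then have "j = length Ts" using flag_Cons.prems by simp
    moreover have "flag_top Ts \<union> (T - flag_top Ts) = T" using flag_Cons(2) by (auto simp: covers_def)
    ultimately show ?thesis
      using flag_Cons(2) Union_blocks[OF flag_Cons(1)] by (simp add: nth_append)
  qed
qed simp

lemma flag_score_eq_sum:
  "flag Ts \<Longrightarrow> flag_score Ts = (\<Sum>j<length Ts. int (card (blocks Ts ! j)) - 1 -
    (if affine_step (block_union (blocks Ts) j) (block_union (blocks Ts) j \<union> blocks Ts ! j) then 1 else 0))"
proof (induction Ts rule: flag.induct)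
  case flag_Nil
  show ?case by (simp add: flag_score_def)
next
  case (flag_Cons Ts T)
  have eq: "flag_top Ts \<union> (T - flag_top Ts) = T" using flag_Cons(2) by (auto simp: covers_def)
  then have "flag_score (T # Ts) = flag_score Ts +
      (int (card (T - flag_top Ts)) - 1 - (if affine_step (flag_top Ts) T then 1 else 0))"
    using flag_score_Cons_union[of "flag_top Ts" Ts "T - flag_top Ts"] flag_Cons(2) by simp
  then show ?case
    using flag_Cons.IH Union_blocks[OF flag_Cons(1)] eq
    by (simp add: nth_append)
qed

lemma flag_iterated_circuit:
  assumes fl: "flag Ts" and ne: "Ts \<noteq> []"
  shows "iterated_circuit A (blocks Ts) \<and> eta A (blocks Ts) = flag_score Ts"
proof -
  let ?Is = "blocks Ts"
  have U: "\<Union>(set ?Is) \<subseteq> {..<n}"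
    using Union_blocks[OF fl] flag_top_cyclic[OF fl] cyclic_subset by simp
  have cov: "covers (block_union ?Is j) (block_union ?Is j \<union> ?Is ! j)"
    and disj: "block_union ?Is j \<inter> ?Is ! j = {}" if "j < length Ts" for j
    using blocks_covers[OF fl that] by auto
  have W: "cyclic (block_union ?Is j)" if "j < length Ts" for j
    using cov[OF that] by (simp add: covers_def)
  have Jn: "?Is ! j \<subseteq> {..<n}" if "j < length Ts" for j
    using U that nth_mem[of j ?Is] by (simp add: Union_upper order_trans[rotated])
  have ne0: "0 < length Ts" using ne by simp
  have cov0: "covers {} ({} \<union> ?Is ! 0)" using cov[OF ne0] by simp
  note rep0 = represents_ambient[OF Jn[OF ne0]]
  have dim: "block_dim ?Is j = int (card (?Is ! j)) - 1 -
      (if affine_step (block_union ?Is j) (block_union ?Is j \<union> ?Is ! j) then 1 else 0)"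
    if j: "j < length Ts" for j
  proof (cases "j = 0")
    case True
    then show ?thesis
      using aff_dim_covers[OF rep0 cyclic_empty Int_empty_left Jn[OF ne0] cov0]
      by (simp add: block_dim_def)
  next
    case False
    have "j < length ?Is" using j by simp
    from aff_dim_covers[OF represents_quotient[OF U this disj[OF j]] W[OF j] disj[OF j] Jn[OF j] cov[OF j]]
    show ?thesis using False by (simp add: block_dim_def)
  qed
  have "iterated_circuit A ?Is"
    unfolding iterated_circuit_def
  proof (intro conjI allI impI ballI)
    show "?Is \<noteq> []" using ne0 by (metis length_blocks length_greater_0_conv)
    show "{} \<notin> set ?Is"
    proof
      assume "{} \<in> set ?Is"
      then obtain j where "j < length Ts" "?Is ! j = {}" by (auto simp: in_set_conv_nth)
      then show False using cov[of j] by (simp add: covers_def)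
    qed
    show "\<Union>(set ?Is) \<subseteq> {..<dim_col A}" using U A_carrier by simp
    show "?Is ! i \<inter> ?Is ! j = {}" if "i < j \<and> j < length ?Is" for i j
    proof -
      have "?Is ! i \<subseteq> block_union ?Is j"
        using that by (intro Union_upper) (auto simp: in_set_conv_nth intro!: exI[of _ i])
      moreover have "j < length Ts" using that by simp
      ultimately show ?thesis using disj[of j] by blast
    qed
    show "circuit (ambient A) (col A) (?Is ! 0)"
      using circuit_iff_covers[OF rep0 Jn[OF ne0]] cov0 by simp
    fix j assume "j \<in> {1..<length ?Is}"
    then have j: "j < length Ts" and j': "j < length ?Is" by auto
    note ctx = represents_quotient[OF U j' disj[OF j]] W[OF j] disj[OF j] Jn[OF j]
    show "circuit (ic_quot A ?Is j) (ic_proj A ?Is j) (?Is ! j) \<and>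
          aff_dim (ic_quot A ?Is j) (ic_proj A ?Is j) (?Is ! j) = 0
        \<or> inj_on (ic_proj A ?Is j) (?Is ! j) \<and>
          min_lin_dependent (ic_quot A ?Is j) (ic_proj A ?Is j) (?Is ! j)"
    proof (cases "inj_on (ic_proj A ?Is j) (?Is ! j)")
      case True
      then show ?thesis using min_lin_dependent_iff[OF ctx] cov[OF j] by simp
    next
      case False
      then show ?thesis using equal_points_circuit[OF ctx cov[OF j]] by simp
    qed
  qed
  moreover have "eta A ?Is = flag_score Ts"
  proof -
    have "?Is \<noteq> []" using ne0 by (metis length_blocks length_greater_0_conv)
    then have "eta A ?Is = (\<Sum>j<length Ts. block_dim ?Is j)"
      using eta_eq_sum_block_dim by simp
    also have "\<dots> = flag_score Ts"
      unfolding flag_score_eq_sum[OF fl] using dim by (intro sum.cong) auto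
    finally show ?thesis .
  qed
  ultimately show ?thesis by blast
qed

text \<open>
  The set of all \<open>\<eta>\<close> is bounded because each iterated circuit is dominated by a flag.  Flags that
  reach all columns have the same length, so the one with the fewest affine steps has the
  largest score.
\<close>

lemma iota_eq:
  assumes n: "n > 0" and fl: "flag Ts" "flag_top Ts = {..<n}"
    and least: "\<And>Ts'. flag Ts' \<Longrightarrow> flag_top Ts' = {..<n} \<Longrightarrow> affine_steps Ts \<le> affine_steps Ts'"
  shows "iota A = flag_score Ts"
proof -
  have le: "eta A Is \<le> flag_score Ts" if ic: "iterated_circuit A Is" for Is
  proof -
    have ne: "Is \<noteq> []" using ic by (simp add: iterated_circuit_def)
    obtain Ts' where Ts': "flag Ts'" "flag_top Ts' = block_union Is (length Is)"
      "(\<Sum>i<length Is. block_dim Is i) \<le> flag_score Ts'"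
      using iterated_circuit_flag[OF ic order_refl] by blast
    have "flag_top Ts' \<subseteq> {..<n}" using flag_top_cyclic[OF Ts'(1)] cyclic_subset by blast
    then obtain Ts'' where Ts'': "flag Ts''" "flag_top Ts'' = {..<n}" "flag_score Ts' \<le> flag_score Ts''"
      using flag_extend[OF Ts'(1) cyclic_UNIV] by blast
    have "length Ts'' = length Ts"
      using dim_flag[OF Ts''(1)] dim_flag[OF fl(1)] Ts''(2) fl(2) by simp
    then have "flag_score Ts'' \<le> flag_score Ts"
      using least[OF Ts''(1,2)] Ts''(2) fl(2) by (simp add: flag_score_def)
    then show ?thesis
      using eta_eq_sum_block_dim[OF ne] Ts'(3) Ts''(3) by simp
  qed
  have nonneg: "0 \<le> eta A Is" if ic: "iterated_circuit A Is" for Is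
  proof -
    have ne: "Is \<noteq> []" and "{} \<notin> set Is" using ic by (auto simp: iterated_circuit_def)
    then have "Is ! j \<noteq> {}" if "j < length Is" for j using that nth_mem by metis
    then have "0 \<le> block_dim Is j" if "j < length Is" for j
      using that ne by (cases "j = 0") (auto simp: block_dim_def aff_dim_def)
    then show ?thesis unfolding eta_eq_sum_block_dim[OF ne] by (intro sum_nonneg) simp
  qed
  have "Ts \<noteq> []" using fl(2) n by (cases Ts) auto
  then have attained: "iterated_circuit A (blocks Ts)" "eta A (blocks Ts) = flag_score Ts"
    using flag_iterated_circuit[OF fl(1)] by auto
  show ?thesis
    unfolding iota_def
  proof (rule Max_eqI)
    have "{eta A Is | Is. iterated_circuit A Is} \<subseteq> {0..flag_score Ts}" using le nonneg by auto
    then show "finite {eta A Is | Is. iterated_circuit A Is}" using finite_subset by blast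
    show "y \<le> flag_score Ts" if "y \<in> {eta A Is | Is. iterated_circuit A Is}" for y
      using that le by blast
    show "flag_score Ts \<in> {eta A Is | Is. iterated_circuit A Is}"
      using attained by (metis (mono_tags, lifting) mem_Collect_eq)
  qed
qed

text \<open>
  The affine relations of all columns are the whole kernel, by homogeneity.
\<close>

lemma config_dim_eq:
  assumes "n > 0"
  shows "config_dim A = int n - 1 - int (subspace_dim n (rel {..<n}))"
proof -
  note rep = represents_ambient[OF order_refl]
  let ?D = "{c \<in> carrier_vec n. supp c \<subseteq> {..<n} \<and> coord_sum {..<n} c = 0 \<and>
      comb (ambient A) (col A) {..<n} (\<lambda>i. c $ i) = \<zero>\<^bsub>ambient A\<^esub>}"
  have "aff_dim (ambient A) (col A) {..<n} = int (card {..<n}) - 1 - int (subspace_dim n ?D)"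
    using rep assms by (intro aff_dim_eq) (auto simp: represents_def)
  moreover have "?D = rel {..<n}"
  proof -
    have "comb (ambient A) (col A) {..<n} (\<lambda>i. c $ i) = \<zero>\<^bsub>ambient A\<^esub> \<longleftrightarrow> c \<in> mat_kernel A"
      if c: "c \<in> carrier_vec n" for c
    proof -
      have "vec n (\<lambda>i. if i \<in> {..<n} then c $ i else 0) = c" using c by (auto simp: vec_eq_iff)
      then show ?thesis
        unfolding comb_ambient[OF order_refl] mat_kernel[OF A_carrier] unfolding ambient_eq
        using c by (simp add: module_vec_simps)
    qed
    then show ?thesis
      unfolding rel_def using K_carrier sum_zero supp_subset by blast
  qed
  ultimately show ?thesis
    unfolding config_dim_def carrier_matD(2)[OF A_carrier] by simp
qed

lemma rho_iota:
  assumes n: "n > 0"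
  shows "int n - 1 - int (rho A) = config_dim A - iota A"
proof -
  let ?P = "\<lambda>Ts. flag Ts \<and> flag_top Ts = {..<n}"
  obtain Ts0 where "?P Ts0" using flag_extend[OF flag_Nil cyclic_UNIV] by auto
  then obtain Ts where Ts: "?P Ts" "\<And>Ts'. ?P Ts' \<Longrightarrow> affine_steps Ts \<le> affine_steps Ts'"
    using ex_has_least_nat[of ?P Ts0 affine_steps] by blast
  have "rho A + affine_steps Ts = n" using Ts by (intro rho_eq) auto
  moreover have "iota A = flag_score Ts" using Ts by (intro iota_eq[OF n]) auto
  moreover have "length Ts = subspace_dim n (rel {..<n})" using dim_flag Ts(1) by metis
  ultimately show ?thesis
    using Ts(1) config_dim_eq[OF n] by (simp add: flag_score_def)
qed

end

section \<open>Homogeneous and non-pyramidal configurations\<close>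

text \<open>
  Induction on the dimension of \<open>L\<close>: reduce modulo a vector \<open>l0\<close> of \<open>L\<close> with nonzero \<open>k\<close>-th
  coordinate, separate the reduced vector from the vectors of \<open>L\<close> vanishing at \<open>k\<close>, and correct the
  functional in the \<open>k\<close>-th coordinate so that it kills \<open>l0\<close>.
\<close>

lemma separating_functional:
  fixes L :: "'k::field vec set"
  assumes "lin_subspace r L" "a \<in> carrier_vec r" "a \<notin> L"
  shows "\<exists>w\<in>carrier_vec r. (\<forall>l\<in>L. w \<bullet> l = 0) \<and> w \<bullet> a \<noteq> 0"
  using assms
proof (induction "subspace_dim r L" arbitrary: L a rule: less_induct)
  case less
  note L = less.prems(1) and a = less.prems(2,3)
  note Lc = lin_subspaceD[OF L]
  show ?case
  proof (cases "L = {0\<^sub>v r}")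
    case True
    then have "a \<noteq> 0\<^sub>v r" using a(2) by blast
    then obtain k where k: "k < r" "a $ k \<noteq> 0" using a(1) by (auto simp: vec_eq_iff)
    then show ?thesis
      using True a(1) by (intro bexI[of _ "unit_vec r k"]) auto
  next
    case False
    then obtain l0 where l0: "l0 \<in> L" "l0 \<noteq> 0\<^sub>v r" using Lc(2) by blast
    have l0c: "l0 \<in> carrier_vec r" using Lc(1)[OF l0(1)] .
    obtain k where k: "k < r" "l0 $ k \<noteq> 0" using l0(2) l0c by (auto simp: vec_eq_iff)
    let ?L = "{l \<in> L. l $ k = 0}"
    let ?red = "\<lambda>v. v + (- (v $ k / l0 $ k)) \<cdot>\<^sub>v l0"
    have red: "?red v \<in> carrier_vec r" "?red v $ k = 0" if "v \<in> carrier_vec r" for v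
      using that l0c k by auto
    have "subspace_dim r ?L < subspace_dim r L"
    proof -
      have "\<exists>v\<in>L. v $ k \<noteq> 0" using l0(1) k(2) by blast
      then show ?thesis using subspace_dim_coordinate(2)[OF L k(1)] by simp
    qed
    moreover have "lin_subspace r ?L" by (rule subspace_dim_coordinate(1)[OF L k(1)])
    moreover have "?red a \<notin> ?L"
    proof
      assume "?red a \<in> ?L"
      then have "?red a \<in> L" by blast
      then have "?red a + (a $ k / l0 $ k) \<cdot>\<^sub>v l0 \<in> L" using Lc(3,4) l0(1) by blast
      moreover have "?red a + (a $ k / l0 $ k) \<cdot>\<^sub>v l0 = a"
        using a(1) l0c by (auto simp: vec_eq_iff)
      ultimately show False using a(2) by simp
    qed
    ultimately obtain w where w: "w \<in> carrier_vec r" "\<forall>l\<in>?L. w \<bullet> l = 0" "w \<bullet> ?red a \<noteq> 0"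
      using less.hyps[of ?L "?red a"] red(1)[OF a(1)] by blast
    \<comment> \<open>The coefficient is chosen so that \<open>?w \<bullet> l0 = 0\<close>.\<close>
    let ?w = "w + (- (w \<bullet> l0 / l0 $ k)) \<cdot>\<^sub>v unit_vec r k"
    have wc: "?w \<in> carrier_vec r" using w(1) by simp
    have prod: "?w \<bullet> v = w \<bullet> ?red v" if v: "v \<in> carrier_vec r" for v
    proof -
      have "?w \<bullet> v = w \<bullet> v + (- (w \<bullet> l0 / l0 $ k)) * (v $ k)"
        using w(1) v k(1) by (simp add: add_scalar_prod_distrib[of _ r])
      moreover have "w \<bullet> ?red v = w \<bullet> v + (- (v $ k / l0 $ k)) * (w \<bullet> l0)"
        using w(1) v l0c by (simp add: scalar_prod_add_distrib[of _ r])
      ultimately show ?thesis by simp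
    qed
    have "?w \<bullet> l = 0" if l: "l \<in> L" for l
    proof -
      have "?red l \<in> L" using Lc(3,4) l l0(1) by blast
      then have "?red l \<in> ?L" using red(2)[OF Lc(1)[OF l]] by blast
      then show ?thesis using prod[OF Lc(1)[OF l]] w(2) by simp
    qed
    moreover have "?w \<bullet> a \<noteq> 0" using prod[OF a(1)] w(3) by simp
    ultimately show ?thesis using wc by blast
  qed
qed

text \<open>
  If all relations vanish at \<open>i\<close>, the \<open>i\<close>-th point is not in the span of the others, and a
  functional separating it from that span defines a hyperplane exhibiting a pyramid.
\<close>

lemma not_pyramid_kernel_full:
  fixes A :: "'k::field mat"
  assumes A: "A \<in> carrier_mat r n" and np: "\<not> pyramid A" and i: "i < n"
  shows "\<exists>v\<in>mat_kernel A. v $ i \<noteq> 0"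
proof (rule ccontr)
  assume no: "\<not> (\<exists>v\<in>mat_kernel A. v $ i \<noteq> 0)"
  let ?S = "{v \<in> carrier_vec n. v $ i = 0} :: 'k vec set"
  let ?L = "(\<lambda>v. A *\<^sub>v v) ` ?S"
  note colA = mult_mat_unit_vec[OF A]
  have L: "lin_subspace r ?L"
    unfolding lin_subspace_iff
  proof (intro conjI ballI allI)
    show "?L \<subseteq> carrier_vec r" using A by auto
    have "0\<^sub>v r = A *\<^sub>v 0\<^sub>v n" "0\<^sub>v n \<in> ?S" using A i by auto
    then show "0\<^sub>v r \<in> ?L" by (rule image_eqI)
  next
    fix a b assume "a \<in> ?L" "b \<in> ?L"
    then obtain v w where v: "v \<in> ?S" "a = A *\<^sub>v v" and w: "w \<in> ?S" "b = A *\<^sub>v w" by blast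
    have "a + b = A *\<^sub>v (v + w)"
      unfolding v(2) w(2) using v(1) w(1) by (intro mult_add_distrib_mat_vec[OF A, symmetric]) auto
    moreover have "v + w \<in> ?S" using v(1) w(1) i by auto
    ultimately show "a + b \<in> ?L" by (rule image_eqI)
  next
    fix c a assume "a \<in> ?L"
    then obtain v where v: "v \<in> ?S" "a = A *\<^sub>v v" by blast
    have "c \<cdot>\<^sub>v a = A *\<^sub>v (c \<cdot>\<^sub>v v)"
      unfolding v(2) using v(1) by (intro mult_mat_vec[OF A, symmetric]) auto
    moreover have "c \<cdot>\<^sub>v v \<in> ?S" using v(1) i by auto
    ultimately show "c \<cdot>\<^sub>v a \<in> ?L" by (rule image_eqI)
  qed
  have "col A i \<notin> ?L"
  proof
    assume "col A i \<in> ?L"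
    then obtain v where v: "v \<in> carrier_vec n" "v $ i = 0" "col A i = A *\<^sub>v v" by blast
    have "A *\<^sub>v (v - unit_vec n i) = A *\<^sub>v v - A *\<^sub>v unit_vec n i"
      by (rule mult_minus_distrib_mat_vec[OF A v(1)]) simp
    also have "\<dots> = 0\<^sub>v r" unfolding colA[OF i] v(3)[symmetric] using A by auto
    finally have "v - unit_vec n i \<in> mat_kernel A"
      unfolding mat_kernel[OF A] using v(1) by simp
    moreover have "(v - unit_vec n i) $ i \<noteq> 0" using v(1,2) i by simp
    ultimately show False using no by blast
  qed
  moreover have "col A i \<in> carrier_vec r" using A i by auto
  ultimately obtain w where w: "w \<in> carrier_vec r" "\<forall>l\<in>?L. w \<bullet> l = 0" "w \<bullet> col A i \<noteq> 0"
    using separating_functional[OF L] by blast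
  have "w \<noteq> 0\<^sub>v r" using w(3) A i by auto
  moreover have "w \<bullet> col A j = 0" if "j < n" "j \<noteq> i" for j
  proof -
    have "col A j = A *\<^sub>v unit_vec n j" using colA[OF that(1)] by simp
    moreover have "unit_vec n j \<in> ?S" using that i by simp
    ultimately have "col A j \<in> ?L" by (rule image_eqI)
    then show ?thesis using w(2) by blast
  qed
  moreover have "col A j \<in> carrier_vec r" if "j < n" for j using A that by auto
  ultimately have "pyramid A"
    unfolding pyramid_def affine_hyperplane_def
    using w(1,3) A i by (intro exI[of _ "{v \<in> carrier_vec r. w \<bullet> v = 0}"]) auto
  then show False using np by blast
qed

text \<open>
  The all-ones vector is a combination of rows of \<open>A\<close>, each of which is orthogonal to the kernel.
\<close>

lemma homogeneous_kernel_sum_zero: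
  fixes A :: "'k::field mat"
  assumes A: "A \<in> carrier_mat r n" and hom: "homogeneous A" and v: "v \<in> mat_kernel A"
  shows "coord_sum {..<n} v = 0"
proof -
  interpret N: vec_space "TYPE('k)" n .
  have vc: "v \<in> carrier_vec n" "A *\<^sub>v v = 0\<^sub>v r" using mat_kernelD[OF A v] by auto
  obtain y where y: "y \<in> carrier_vec r" "A\<^sup>T *\<^sub>v y = vec n (\<lambda>_. 1)"
    using hom A N.row_space_eq[OF A] unfolding homogeneous_def by auto
  have "coord_sum {..<n} v = vec n (\<lambda>_. 1) \<bullet> v"
    using vc(1) by (simp add: coord_sum_def scalar_prod_def atLeast0LessThan)
  also have "\<dots> = y \<bullet> (A *\<^sub>v v)"
    unfolding y(2)[symmetric] by (rule transpose_vec_mult_scalar[OF A vc(1) y(1)])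
  also have "\<dots> = 0" unfolding vc(2) using y(1) by simp
  finally show ?thesis .
qed

section \<open>Rank of chain matrices and length of iterated circuits\<close>

theorem theorem2p7:
  fixes A :: "'k::field_char_0 mat" and d n :: nat
  assumes "A \<in> carrier_mat (d + 1) n"
    and "homogeneous A"
    and "\<not> pyramid A"
    and "config_dim A = int d"
  shows "int n - 1 - int (rho A) = config_dim A - iota A"
proof -
  have n: "n > 0"
    using assms(1,4) unfolding config_dim_def aff_dim_def by (cases "n = 0") auto
  interpret configuration n A "d + 1"
  proof (intro configuration.intro relation_space.intro configuration_axioms.intro)
    show "lin_subspace n (mat_kernel A)" by (rule rank_plus_kernel_dim(1)[OF assms(1)])
    show "coord_sum {..<n} v = 0" if "v \<in> mat_kernel A" for v
      by (rule homogeneous_kernel_sum_zero[OF assms(1,2) that])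
    show "\<exists>v\<in>mat_kernel A. v $ i \<noteq> 0" if "i < n" for i
      by (rule not_pyramid_kernel_full[OF assms(1,3) that])
    show "A \<in> carrier_mat (d + 1) n" by (rule assms(1))
  qed
  show ?thesis by (rule rho_iota[OF n])
qed

end
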